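(* Let $\alpha\in(0,2]$. Let $X_1,X_2,\ldots$ be independent, not necessarily identically distributed random variables with $\mathsf{E}X_i=0$ and $0<\sigma_i^2=\mathsf{D}X_i<\infty$, $i\ge1$, satisfying the Lindeberg condition: for any $\tau>0$ $$\lim_{n\to\infty}\frac{1}{B_n^2}\sum_{i=1}^n\int_{|x|\ge\tau B_n}x^2\,d\mathsf{P}(X_i<x)=0 .$$ Let $N_1,N_2,\ldots$ be nonnegative integer-valued random variables such that for each $n$ the random variables $N_n,X_1,X_2,\ldots$ are independent, and let $N_n\to\infty$ in probability as $n\to\infty$. Let $\{d_n\}_{n\ge1}$ be an infinitely increasing sequence of positive numbers. Then, as $n\to\infty$, the following statements are equivalent: $$\frac{B^2_{N_n}}{d_n^2}\Longrightarrow M_{\alpha/2};\qquad \frac{S^*_{N_n}}{d_n}\Longrightarrow L_\alpha;\qquad \frac{\overline S^*_{N_n}}{d_n}\Longrightarrow |L_\alpha|;\qquad \frac{\underline S^*_{N_n}}{d_n}\Longrightarrow -|L_\alpha|;\qquad \frac{|S^*_{N_n}|}{d_n}\Longrightarrow |L_\alpha|.$$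
   Context: $\mathsf{D}$ denotes variance. $S_n^*=X_1+\ldots+X_n$, $B_n^2=\sigma_1^2+\ldots+\sigma_n^2$, $\overline S^*_n=\max_{1\le i\le n}S^*_i$, $\underline S^*_n=\min_{1\le i\le n}S^*_i$, with empty sums equal to $0$ and $S^*_0=\overline S^*_0=\underline S^*_0=0$; the random-index versions are obtained by substituting $N_n$ for $n$. $\Longrightarrow$ denotes convergence in distribution. $N_n\to\infty$ in probability means $\mathsf{P}(N_n\le m)\to0$ as $n\to\infty$ for any $m\in(0,\infty)$. For $\alpha\in(0,2]$, $L_\alpha$ is a random variable with the Linnik distribution with parameter $\alpha$, i.e. with characteristic function $1/(1+|t|^{\alpha})$, $t\in\mathbb{R}$ (the distribution of $|L_\alpha|$ is called the one-sided Linnik distribution). For $\delta\in(0,1]$, $M_\delta$ is a nonnegative random variable with the (standard) Mittag-Leffler distribution with parameter $\delta$, i.e. with Laplace transform $\mathsf{E}e^{-sM_\delta}=1/(1+s^{\delta})$, $s\ge 0$.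
   Formalization: The first statement reads B²_{N_n}/d_n² ⟹ 2M_{α/2} instead of M_{α/2}; with the given normalisations the original fails, e.g. for α=2, X_i i.i.d. N(0,1), N_n geometric with mean n, d_n=√n. *)

theory Defs
  imports "HOL-Probability.Probability"
begin

text \<open>
  Sequences are indexed by \<open>n \<ge> 1\<close> as usual in probability theory; \<open>X 0\<close> is never used.
\<close>

definition partial_sum :: "(nat \<Rightarrow> 'a \<Rightarrow> real) \<Rightarrow> nat \<Rightarrow> 'a \<Rightarrow> real" where
  "partial_sum X n \<omega> = (\<Sum>i=1..n. X i \<omega>)"

text \<open>
  The maximum and minimum range over \<open>1 \<le> i \<le> n\<close>, so for \<open>n \<ge> 1\<close> the value \<open>0\<close> of the
  empty sum does not take part.
\<close>

definition max_partial_sum :: "(nat \<Rightarrow> 'a \<Rightarrow> real) \<Rightarrow> nat \<Rightarrow> 'a \<Rightarrow> real" where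
  "max_partial_sum X n \<omega> =
     (if n = 0 then 0 else Max ((\<lambda>i. partial_sum X i \<omega>) ` {1..n}))"

definition min_partial_sum :: "(nat \<Rightarrow> 'a \<Rightarrow> real) \<Rightarrow> nat \<Rightarrow> 'a \<Rightarrow> real" where
  "min_partial_sum X n \<omega> =
     (if n = 0 then 0 else Min ((\<lambda>i. partial_sum X i \<omega>) ` {1..n}))"

definition sum_variance :: "'a measure \<Rightarrow> (nat \<Rightarrow> 'a \<Rightarrow> real) \<Rightarrow> nat \<Rightarrow> real" where
  "sum_variance M X n = (\<Sum>i=1..n. prob_space.variance M (X i))"

definition lindeberg :: "'a measure \<Rightarrow> (nat \<Rightarrow> 'a \<Rightarrow> real) \<Rightarrow> bool" where
  "lindeberg M X \<longleftrightarrow> (\<forall>\<tau>>0.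
     (\<lambda>n. (1 / sum_variance M X n) *
        (\<Sum>i=1..n. LINT x:{x. \<bar>x\<bar> \<ge> \<tau> * sqrt (sum_variance M X n)}|distr M borel (X i). x\<^sup>2))
     \<longlonglongrightarrow> 0)"

definition tends_to_infinity_in_prob :: "'a measure \<Rightarrow> (nat \<Rightarrow> 'a \<Rightarrow> nat) \<Rightarrow> bool" where
  "tends_to_infinity_in_prob M N \<longleftrightarrow>
     (\<forall>m::real. m > 0 \<longrightarrow> (\<lambda>n. measure M {\<omega> \<in> space M. real (N n \<omega>) \<le> m}) \<longlonglongrightarrow> 0)"

definition converges_in_distribution ::
  "'a measure \<Rightarrow> (nat \<Rightarrow> 'a \<Rightarrow> real) \<Rightarrow> 'b measure \<Rightarrow> ('b \<Rightarrow> real) \<Rightarrow> bool" where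
  "converges_in_distribution M Y P Z \<longleftrightarrow>
     weak_conv_m (\<lambda>n. distr M borel (Y n)) (distr P borel Z)"

definition linnik_rv :: "real \<Rightarrow> 'b measure \<Rightarrow> ('b \<Rightarrow> real) \<Rightarrow> bool" where
  "linnik_rv \<alpha> P L \<longleftrightarrow> prob_space P \<and> L \<in> borel_measurable P \<and>
     (\<forall>t. char (distr P borel L) t = complex_of_real (1 / (1 + \<bar>t\<bar> powr \<alpha>)))"

text \<open>
  With these standard normalisations and \<open>Z\<close> standard normal, independent of the
  Mittag-Leffler variable \<open>V\<close> with parameter \<open>\<alpha> / 2\<close>, conditioning on \<open>V\<close> gives
  \<open>E exp (i t Z sqrt (c V)) = E exp (- c t\<^sup>2 V / 2) = 1 / (1 + (c / 2) powr (\<alpha> / 2) * \<bar>t\<bar> powr \<alpha>)\<close>.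
  Hence the Linnik law with parameter \<open>\<alpha>\<close> is that of \<open>Z sqrt (2 V)\<close>: when the random sums
  converge to it, their random variances converge to \<open>2 V\<close>, not to \<open>V\<close>.
\<close>

definition mittag_leffler_rv :: "real \<Rightarrow> 'c measure \<Rightarrow> ('c \<Rightarrow> real) \<Rightarrow> bool" where
  "mittag_leffler_rv \<delta> P V \<longleftrightarrow> prob_space P \<and> V \<in> borel_measurable P \<and>
     (\<forall>\<omega>\<in>space P. V \<omega> \<ge> 0) \<and>
     (\<forall>s\<ge>0. integral\<^sup>L P (\<lambda>\<omega>. exp (- s * V \<omega>)) = 1 / (1 + s powr \<delta>))"

end

theory Submission
  imports Defs
begin

text \<open>
  Let \<open>S k\<close> be the sum of the first \<open>k\<close> summands and \<open>(B k)\<^sup>2\<close> its variance. Write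
  \<open>U n = B (N n) / d n\<close> and let \<open>Z\<close> be standard normal and independent of \<open>N n\<close>. The five
  statements are all reduced to the weak convergence of the mixtures \<open>U n * Z\<close>.

  For a fixed number \<open>k\<close> of summands, the Lindeberg condition gives three limit theorems:
  \<open>S k / B k\<close> tends to \<open>Z\<close>, the maximum of the partial sums divided by \<open>B k\<close> tends to \<open>\<bar>Z\<bar>\<close>, and
  the minimum tends to \<open>- \<bar>Z\<bar>\<close> (\<open>lindeberg_clt\<close>, \<open>max_partial_sum_weak_conv\<close>,
  \<open>min_partial_sum_weak_conv\<close>). The first is Lindeberg's theorem. The second is an approximate
  reflection principle: when the partial sums first exceed a level they overshoot it only a
  little, and the increment that follows is, uniformly in the time of passage, nearly symmetric,
  because it is nearly normal. Hence the final sum lies above or below the level with nearly equal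
  probability, and the maximum exceeds \<open>x\<close> about twice as often as the final sum does.

  The limit laws have continuous distribution functions, so these convergences are uniform on
  the line (\<open>weak_conv_m_uniform\<close>). Since \<open>N n\<close> is independent of the summands and tends to
  infinity, averaging over \<open>N n\<close> shows that at every point the distribution function of
  \<open>S (N n) / d n\<close> differs from that of \<open>U n * Z\<close> by a null sequence, whether or not these laws are
  tight; the same holds for the maximum, the minimum and the modulus, with \<open>\<bar>Z\<bar>\<close>, \<open>- \<bar>Z\<bar>\<close> and
  \<open>\<bar>Z\<bar>\<close> in place of \<open>Z\<close> (\<open>random_index_weak_conv_iff\<close>). So the last four statements concern
  \<open>U n * Z\<close>, \<open>U n * \<bar>Z\<bar>\<close> and \<open>- U n * \<bar>Z\<bar>\<close>, and they are equivalent to one another because a law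
  with a real characteristic function is determined, also in the limit, by the law of its modulus
  (\<open>weak_conv_m_abs_iff\<close>).

  Finally, the characteristic function of \<open>U n * Z\<close> at \<open>t\<close> is the Laplace transform of \<open>(U n)\<^sup>2\<close> at
  \<open>t\<^sup>2 / 2\<close>, and that of \<open>L\<close> at \<open>t\<close> is the Laplace transform of \<open>2 V\<close> at \<open>t\<^sup>2 / 2\<close>. By the continuity
  theorems for both transforms, \<open>U n * Z\<close> tends to \<open>L\<close> if and only if \<open>(U n)\<^sup>2\<close> tends to \<open>2 V\<close>
  (\<open>normal_mixture_linnik_iff\<close>).
\<close>

section \<open>The Lindeberg central limit theorem for increments\<close>

lemma exp_neg_linear_approx:
  assumes "0 \<le> (y::real)"
  shows "\<bar>exp (- y) - (1 - y)\<bar> \<le> y\<^sup>2 / 2"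
proof -
  have 1: "1 - y \<le> exp (- y)"
    using exp_ge_add_one_self[of "- y"] by simp
  have "1 + y + y\<^sup>2 / 2 \<le> exp y"
    using exp_lower_Taylor_quadratic[OF assms] by simp
  moreover have "0 < 1 + y + y\<^sup>2 / 2"
    using assms by (intro add_pos_nonneg) auto
  ultimately have "exp (- y) \<le> 1 / (1 + y + y\<^sup>2 / 2)"
    by (simp add: exp_minus inverse_eq_divide divide_simps)
  also have "\<dots> \<le> 1 - y + y\<^sup>2 / 2"
  proof -
    have "(1 - y + y\<^sup>2 / 2) * (1 + y + y\<^sup>2 / 2) = 1 + (y\<^sup>2)\<^sup>2 / 4"
      by (simp add: field_simps power2_eq_square)
    then have "1 \<le> (1 - y + y\<^sup>2 / 2) * (1 + y + y\<^sup>2 / 2)"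
      by simp
    with \<open>0 < 1 + y + y\<^sup>2 / 2\<close> show ?thesis
      by (simp add: pos_divide_le_eq)
  qed
  finally show ?thesis
    using 1 by simp
qed

lemma char_scaled_std_normal:
  "char (distr std_normal_distribution borel (\<lambda>z. c * z)) t = complex_of_real (exp (- (c * t)\<^sup>2 / 2))"
proof -
  have "char (distr std_normal_distribution borel (\<lambda>z. c * z)) t = char std_normal_distribution (c * t)"
    by (simp add: char_def integral_distr ac_simps)
  then show ?thesis
    by (simp add: char_std_normal_distribution)
qed

locale lindeberg_sequence = prob_space M for M :: "'a measure" +
  fixes X :: "nat \<Rightarrow> 'a \<Rightarrow> real"
  assumes indep: "indep_vars (\<lambda>_. borel) X {1..}"
    and square_integrable: "i \<ge> 1 \<Longrightarrow> integrable M (\<lambda>\<omega>. (X i \<omega>)\<^sup>2)"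
    and mean_zero: "i \<ge> 1 \<Longrightarrow> expectation (X i) = 0"
    and variance_pos: "i \<ge> 1 \<Longrightarrow> 0 < variance (X i)"
    and lindeberg: "lindeberg M X"
begin

abbreviation "B2 \<equiv> sum_variance M X"
abbreviation "B k \<equiv> sqrt (B2 k)"

text \<open>
  The summand with index \<open>i\<close> contributes \<open>tail_moment k \<tau> i\<close> to the numerator of the Lindeberg ratio
  \<open>lindeberg_ratio k \<tau>\<close>, expressed on \<open>M\<close> instead of on the laws of the summands.
\<close>

definition tail_moment :: "nat \<Rightarrow> real \<Rightarrow> nat \<Rightarrow> real" where
  "tail_moment k \<tau> i = expectation (\<lambda>\<omega>. indicator {x. \<bar>x\<bar> \<ge> \<tau> * B k} (X i \<omega>) * (X i \<omega>)\<^sup>2)"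

definition lindeberg_ratio :: "nat \<Rightarrow> real \<Rightarrow> real" where
  "lindeberg_ratio k \<tau> = (\<Sum>i=1..k. tail_moment k \<tau> i) / B2 k"

lemma X_measurable [measurable]: "i \<ge> 1 \<Longrightarrow> X i \<in> borel_measurable M"
  using indep by (auto simp: indep_vars_def2)

lemma X_integrable: "i \<ge> 1 \<Longrightarrow> integrable M (X i)"
  by (rule square_integrable_imp_integrable) (auto intro: square_integrable)

lemma variance_eq: "i \<ge> 1 \<Longrightarrow> variance (X i) = expectation (\<lambda>\<omega>. (X i \<omega>)\<^sup>2)"
  by (simp add: mean_zero)

lemma B2_pos: "k \<ge> 1 \<Longrightarrow> 0 < B2 k"
  unfolding sum_variance_def by (intro sum_pos variance_pos) auto

lemma B2_0 [simp]: "B2 0 = 0"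
  by (simp add: sum_variance_def)

lemma B2_split: "j \<le> k \<Longrightarrow> B2 k - B2 j = (\<Sum>i\<in>{j<..k}. variance (X i))"
proof -
  assume "j \<le> k"
  then have "{1..k} = {1..j} \<union> {j<..k}" by auto
  then have "B2 k = B2 j + (\<Sum>i\<in>{j<..k}. variance (X i))"
    unfolding sum_variance_def by (subst sum.union_disjoint[symmetric]) auto
  then show ?thesis by simp
qed

lemma B2_mono: "j \<le> k \<Longrightarrow> B2 j \<le> B2 k"
proof -
  assume jk: "j \<le> k"
  have "0 \<le> (\<Sum>i\<in>{j<..k}. variance (X i))"
    by (intro sum_nonneg Bochner_Integration.integral_nonneg) auto
  with B2_split[OF jk] show ?thesis by simp
qed

lemma tail_moment_integrable:
  "i \<ge> 1 \<Longrightarrow> integrable M (\<lambda>\<omega>. indicator {x. \<bar>x\<bar> \<ge> c} (X i \<omega>) * (X i \<omega>)\<^sup>2)"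
  by (rule Bochner_Integration.integrable_bound[OF square_integrable[of i]])
     (auto simp: indicator_def)

lemma tail_moment_nonneg: "0 \<le> tail_moment k \<tau> i"
  unfolding tail_moment_def by (intro Bochner_Integration.integral_nonneg) auto

lemma lindeberg_ratio_tendsto:
  assumes "0 < \<tau>" shows "(\<lambda>k. lindeberg_ratio k \<tau>) \<longlonglongrightarrow> 0"
proof -
  have eq: "(LINT x:{x. \<bar>x\<bar> \<ge> c}|distr M borel (X i). x\<^sup>2)
      = expectation (\<lambda>\<omega>. indicator {x. \<bar>x\<bar> \<ge> c} (X i \<omega>) * (X i \<omega>)\<^sup>2)" if "i \<ge> 1" for c i
    using that by (simp add: set_lebesgue_integral_def integral_distr)
  have "lindeberg_ratio k \<tau> = (1 / B2 k) *
      (\<Sum>i=1..k. LINT x:{x. \<bar>x\<bar> \<ge> \<tau> * B k}|distr M borel (X i). x\<^sup>2)" for k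
    unfolding lindeberg_ratio_def tail_moment_def by (simp add: eq)
  then show ?thesis
    using lindeberg assms by (simp add: lindeberg_def)
qed

lemma tail_moment_le: "i \<in> {1..k} \<Longrightarrow> tail_moment k \<tau> i \<le> lindeberg_ratio k \<tau> * B2 k"
proof -
  assume i: "i \<in> {1..k}"
  then have "0 < B2 k" by (intro B2_pos) auto
  moreover have "tail_moment k \<tau> i \<le> (\<Sum>i=1..k. tail_moment k \<tau> i)"
    by (rule member_le_sum[OF i]) (auto simp: tail_moment_nonneg)
  ultimately show ?thesis by (simp add: lindeberg_ratio_def)
qed

text \<open>
  The Lindeberg condition makes every single summand asymptotically negligible: below the
  truncation level its square is at most \<open>\<tau>\<^sup>2 * B2 k\<close>.
\<close>

lemma variance_share_le:
  assumes i: "i \<in> {1..k}" and "0 \<le> \<tau>"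
  shows "variance (X i) / B2 k \<le> \<tau>\<^sup>2 + lindeberg_ratio k \<tau>"
proof -
  have B: "0 < B2 k" using i by (intro B2_pos) auto
  have i1: "i \<ge> 1" using i by auto
  have "variance (X i) = expectation (\<lambda>\<omega>. (X i \<omega>)\<^sup>2)"
    by (rule variance_eq[OF i1])
  also have "\<dots> \<le> expectation (\<lambda>\<omega>. indicator {x. \<bar>x\<bar> \<ge> \<tau> * B k} (X i \<omega>) * (X i \<omega>)\<^sup>2 + \<tau>\<^sup>2 * B2 k)"
  proof (intro integral_mono)
    fix \<omega>
    show "(X i \<omega>)\<^sup>2 \<le> indicator {x. \<bar>x\<bar> \<ge> \<tau> * B k} (X i \<omega>) * (X i \<omega>)\<^sup>2 + \<tau>\<^sup>2 * B2 k"
    proof (cases "\<bar>X i \<omega>\<bar> \<ge> \<tau> * B k")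
      case True
      then show ?thesis using B by (simp add: indicator_def)
    next
      case False
      then have "\<bar>X i \<omega>\<bar>\<^sup>2 \<le> (\<tau> * B k)\<^sup>2"
        by (intro power_mono) auto
      also have "(\<tau> * B k)\<^sup>2 = \<tau>\<^sup>2 * B2 k"
        using B by (simp add: power_mult_distrib)
      finally show ?thesis using False by (simp add: indicator_def)
    qed
  qed (use i1 in \<open>auto intro!: square_integrable tail_moment_integrable\<close>)
  also have "\<dots> = tail_moment k \<tau> i + \<tau>\<^sup>2 * B2 k"
    using i1 by (simp add: tail_moment_def tail_moment_integrable prob_space)
  also have "\<dots> \<le> (\<tau>\<^sup>2 + lindeberg_ratio k \<tau>) * B2 k"
    using tail_moment_le[OF i] by (simp add: algebra_simps)
  finally show ?thesis
    using B by (simp add: pos_divide_le_eq)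
qed

text \<open>
  Both the characteristic function and the Gaussian factor are compared with their common
  quadratic Taylor polynomial. The cubic remainder of the former is used only below the
  truncation level; above it, the quadratic bound yields the tail moment.
\<close>

lemma char_summand_bound:
  assumes i: "i \<in> {1..k}" and \<tau>: "0 \<le> \<tau>"
  shows "cmod (char (distr M borel (X i)) (t / B k) - exp (- (t\<^sup>2 / 2 * (variance (X i) / B2 k))))
    \<le> t\<^sup>2 * (tail_moment k \<tau> i / B2 k)
      + (\<bar>t\<bar> ^ 3 * \<tau> / 6 + t ^ 4 / 8 * (\<tau>\<^sup>2 + lindeberg_ratio k \<tau>)) * (variance (X i) / B2 k)"
proof -
  have B: "0 < B2 k" using i by (intro B2_pos) auto
  have i1: "i \<ge> 1" using i by auto
  define s where "s = t / B k"
  define y where "y = t\<^sup>2 / 2 * (variance (X i) / B2 k)"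
  define v where "v = variance (X i)"
  have v: "0 < v" "expectation (\<lambda>\<omega>. (X i \<omega>)\<^sup>2) = v"
    using variance_pos[OF i1] variance_eq[OF i1] by (simp_all add: v_def)
  have s2: "s\<^sup>2 = t\<^sup>2 / B2 k" "\<bar>s\<bar> * B k = \<bar>t\<bar>"
    using B by (simp_all add: s_def power_divide)
  have y: "y = s\<^sup>2 * v / 2" "0 \<le> y"
    using B v by (simp_all add: y_def s2 v_def)
  have "cmod (char (distr M borel (X i)) s - (1 - s\<^sup>2 * v / 2))
      \<le> s\<^sup>2 / 6 * expectation (\<lambda>\<omega>. min (6 * (X i \<omega>)\<^sup>2) (\<bar>s\<bar> * \<bar>X i \<omega>\<bar> ^ 3))"
    using i1 by (intro char_approx3') (auto simp: X_integrable square_integrable mean_zero v_def)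
  also have "expectation (\<lambda>\<omega>. min (6 * (X i \<omega>)\<^sup>2) (\<bar>s\<bar> * \<bar>X i \<omega>\<bar> ^ 3))
      \<le> expectation (\<lambda>\<omega>. 6 * (indicator {x. \<bar>x\<bar> \<ge> \<tau> * B k} (X i \<omega>) * (X i \<omega>)\<^sup>2)
            + (\<bar>t\<bar> * \<tau>) * (X i \<omega>)\<^sup>2)"
  proof (intro integral_mono)
    show "integrable M (\<lambda>\<omega>. min (6 * (X i \<omega>)\<^sup>2) (\<bar>s\<bar> * \<bar>X i \<omega>\<bar> ^ 3))"
      by (rule Bochner_Integration.integrable_bound[OF integrable_mult_right[OF square_integrable[OF i1], of 6]])
         (use i1 in auto)
    fix \<omega>
    show "min (6 * (X i \<omega>)\<^sup>2) (\<bar>s\<bar> * \<bar>X i \<omega>\<bar> ^ 3)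
        \<le> 6 * (indicator {x. \<bar>x\<bar> \<ge> \<tau> * B k} (X i \<omega>) * (X i \<omega>)\<^sup>2) + (\<bar>t\<bar> * \<tau>) * (X i \<omega>)\<^sup>2"
    proof (cases "\<bar>X i \<omega>\<bar> \<ge> \<tau> * B k")
      case True
      have "0 \<le> (\<bar>t\<bar> * \<tau>) * (X i \<omega>)\<^sup>2" using \<tau> by simp
      then show ?thesis using True by (simp add: indicator_def min.coboundedI1)
    next
      case False
      have "\<bar>s\<bar> * \<bar>X i \<omega>\<bar> ^ 3 = \<bar>s\<bar> * \<bar>X i \<omega>\<bar> * (X i \<omega>)\<^sup>2"
        by (simp add: power3_eq_cube power2_eq_square)
      also have "\<dots> \<le> \<bar>s\<bar> * (\<tau> * B k) * (X i \<omega>)\<^sup>2"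
        using False by (intro mult_right_mono mult_left_mono) auto
      also have "\<dots> = (\<bar>s\<bar> * B k) * \<tau> * (X i \<omega>)\<^sup>2"
        by (simp add: ac_simps)
      finally show ?thesis using False by (simp add: indicator_def s2 min.coboundedI2)
    qed
  qed (use i1 in \<open>intro Bochner_Integration.integrable_add integrable_mult_right
         square_integrable tail_moment_integrable\<close>)
  also have "\<dots> = 6 * tail_moment k \<tau> i + \<bar>t\<bar> * \<tau> * v"
    using i1 by (simp add: tail_moment_def tail_moment_integrable square_integrable v)
  finally have 1: "cmod (char (distr M borel (X i)) s - (1 - s\<^sup>2 * v / 2))
      \<le> s\<^sup>2 / 6 * (6 * tail_moment k \<tau> i + \<bar>t\<bar> * \<tau> * v)"
    by (simp add: mult_left_mono)
  have 2: "\<bar>exp (- y) - (1 - y)\<bar> \<le> t ^ 4 / 8 * (\<tau>\<^sup>2 + lindeberg_ratio k \<tau>) * (v / B2 k)"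
  proof -
    have "\<bar>exp (- y) - (1 - y)\<bar> \<le> y\<^sup>2 / 2"
      by (rule exp_neg_linear_approx[OF y(2)])
    also have "\<dots> = t ^ 4 / 8 * (v / B2 k) * (v / B2 k)"
      unfolding y_def v_def[symmetric] by (simp add: field_simps power2_eq_square power4_eq_xxxx)
    also have "\<dots> \<le> t ^ 4 / 8 * (\<tau>\<^sup>2 + lindeberg_ratio k \<tau>) * (v / B2 k)"
      using variance_share_le[OF i \<tau>] B v by (intro mult_right_mono mult_left_mono) (auto simp: v_def)
    finally show ?thesis .
  qed
  have "cmod (char (distr M borel (X i)) s - exp (- y))
      \<le> cmod (char (distr M borel (X i)) s - (1 - s\<^sup>2 * v / 2))
        + cmod (complex_of_real (1 - y) - complex_of_real (exp (- y)))"
    by (rule order_trans[OF _ norm_triangle_ineq]) (simp add: y)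
  also have "cmod (complex_of_real (1 - y) - complex_of_real (exp (- y))) = \<bar>exp (- y) - (1 - y)\<bar>"
    by (metis abs_minus_commute norm_of_real of_real_diff)
  finally have "cmod (char (distr M borel (X i)) s - exp (- y))
     \<le> s\<^sup>2 / 6 * (6 * tail_moment k \<tau> i + \<bar>t\<bar> * \<tau> * v) + t ^ 4 / 8 * (\<tau>\<^sup>2 + lindeberg_ratio k \<tau>) * (v / B2 k)"
    using 1 2 by simp
  also have "s\<^sup>2 / 6 * (6 * tail_moment k \<tau> i + \<bar>t\<bar> * \<tau> * v)
      = t\<^sup>2 * (tail_moment k \<tau> i / B2 k) + \<bar>t\<bar> ^ 3 * \<tau> / 6 * (v / B2 k)"
    unfolding s2 using B by (simp add: field_simps power3_eq_cube power2_eq_square)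
  finally show ?thesis
    unfolding s_def[symmetric] v_def[symmetric] y_def[folded v_def, symmetric] by (simp only: algebra_simps)
qed

text \<open>
  The error bounds of the summands add up, and adding the summands up to \<open>j\<close> as well gives a
  bound that does not depend on \<open>j\<close>.
\<close>

lemma char_increment_bound:
  assumes k: "1 \<le> k" and jk: "j \<le> k" and \<tau>: "0 \<le> \<tau>"
  shows "cmod (char (distr M borel (\<lambda>\<omega>. (\<Sum>i\<in>{j<..k}. X i \<omega>) / B k)) t
            - exp (- (t\<^sup>2 / 2 * (1 - B2 j / B2 k))))
    \<le> t\<^sup>2 * lindeberg_ratio k \<tau> + (\<bar>t\<bar> ^ 3 * \<tau> / 6 + t ^ 4 / 8 * (\<tau>\<^sup>2 + lindeberg_ratio k \<tau>))"
proof -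
  have B: "0 < B2 k" using k by (rule B2_pos)
  define c where "c = \<bar>t\<bar> ^ 3 * \<tau> / 6 + t ^ 4 / 8 * (\<tau>\<^sup>2 + lindeberg_ratio k \<tau>)"
  define \<psi> where "\<psi> i = complex_of_real (exp (- (t\<^sup>2 / 2 * (variance (X i) / B2 k))))" for i
  have char_eq: "char (distr M borel (\<lambda>\<omega>. (\<Sum>i\<in>{j<..k}. X i \<omega>) / B k)) t
      = (\<Prod>i\<in>{j<..k}. char (distr M borel (X i)) (t / B k))"
  proof -
    have rv: "(\<lambda>\<omega>. \<Sum>i\<in>{j<..k}. X i \<omega>) \<in> borel_measurable M"
      by (intro borel_measurable_sum X_measurable) auto
    have "char (distr M borel (\<lambda>\<omega>. (\<Sum>i\<in>{j<..k}. X i \<omega>) / B k)) t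
        = char (distr M borel (\<lambda>\<omega>. \<Sum>i\<in>{j<..k}. X i \<omega>)) (t / B k)"
      using rv by (simp add: char_def integral_distr)
    also have "\<dots> = (\<Prod>i\<in>{j<..k}. char (distr M borel (X i)) (t / B k))"
      by (intro char_distr_sum indep_vars_subset[OF indep]) auto
    finally show ?thesis .
  qed
  have exp_eq: "exp (- (t\<^sup>2 / 2 * (1 - B2 j / B2 k))) = (\<Prod>i\<in>{j<..k}. \<psi> i)"
  proof -
    have "1 - B2 j / B2 k = (\<Sum>i\<in>{j<..k}. variance (X i) / B2 k)"
      using B B2_split[OF jk] by (simp add: sum_divide_distrib[symmetric] diff_divide_distrib[symmetric] divide_simps)
    then have "exp (- (t\<^sup>2 / 2 * (1 - B2 j / B2 k)))
        = (\<Prod>i\<in>{j<..k}. exp (- (t\<^sup>2 / 2 * (variance (X i) / B2 k))))"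
      by (simp add: exp_sum[symmetric] sum_distrib_left sum_negf[symmetric])
    then show ?thesis by (simp add: \<psi>_def)
  qed
  have "cmod ((\<Prod>i\<in>{j<..k}. char (distr M borel (X i)) (t / B k)) - (\<Prod>i\<in>{j<..k}. \<psi> i))
      \<le> (\<Sum>i\<in>{j<..k}. cmod (char (distr M borel (X i)) (t / B k) - \<psi> i))"
  proof (rule norm_prod_diff)
    fix i assume "i \<in> {j<..k}"
    then have i: "i \<ge> 1" by auto
    then interpret Xi: real_distribution "distr M borel (X i)"
      by (intro real_distribution_distr) auto
    show "cmod (char (distr M borel (X i)) (t / B k)) \<le> 1"
      by (rule Xi.cmod_char_le_1)
    have "0 \<le> t\<^sup>2 / 2 * (variance (X i) / B2 k)"
      using variance_pos[OF i] B by (intro mult_nonneg_nonneg divide_nonneg_nonneg) auto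
    then show "cmod (\<psi> i) \<le> 1"
      unfolding \<psi>_def by simp
  qed
  also have "\<dots> \<le> (\<Sum>i=1..k. cmod (char (distr M borel (X i)) (t / B k) - \<psi> i))"
    by (intro sum_mono2) auto
  also have "\<dots> \<le> (\<Sum>i=1..k. t\<^sup>2 * (tail_moment k \<tau> i / B2 k) + c * (variance (X i) / B2 k))"
    unfolding \<psi>_def c_def by (intro sum_mono char_summand_bound \<tau>)
  also have "\<dots> = t\<^sup>2 * ((\<Sum>i=1..k. tail_moment k \<tau> i) / B2 k) + c * ((\<Sum>i=1..k. variance (X i)) / B2 k)"
    by (simp add: sum.distrib sum_distrib_left sum_divide_distrib)
  also have "\<dots> = t\<^sup>2 * lindeberg_ratio k \<tau> + c"
    using B by (simp add: lindeberg_ratio_def sum_variance_def)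
  finally show ?thesis
    unfolding char_eq exp_eq c_def by simp
qed

lemma char_increment_uniform:
  assumes "0 < \<delta>"
  shows "\<forall>\<^sub>F k in sequentially. \<forall>j\<le>k.
    cmod (char (distr M borel (\<lambda>\<omega>. (\<Sum>i\<in>{j<..k}. X i \<omega>) / B k)) t
            - exp (- (t\<^sup>2 / 2 * (1 - B2 j / B2 k)))) < \<delta>"
proof -
  have "((\<lambda>\<tau>. \<bar>t\<bar> ^ 3 * \<tau> / 6 + t ^ 4 / 8 * \<tau>\<^sup>2) \<longlongrightarrow> \<bar>t\<bar> ^ 3 * 0 / 6 + t ^ 4 / 8 * 0\<^sup>2) (at_right (0::real))"
    by (intro tendsto_intros) auto
  then have "\<forall>\<^sub>F \<tau> in at_right 0. \<bar>t\<bar> ^ 3 * \<tau> / 6 + t ^ 4 / 8 * \<tau>\<^sup>2 < \<delta>"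
    using assms by (auto dest: order_tendstoD(2))
  then have "\<forall>\<^sub>F \<tau> in at_right 0. \<bar>t\<bar> ^ 3 * \<tau> / 6 + t ^ 4 / 8 * \<tau>\<^sup>2 < \<delta> \<and> 0 < \<tau>"
    by (intro eventually_conj eventually_at_right_less)
  then obtain \<tau> where \<tau>: "\<bar>t\<bar> ^ 3 * \<tau> / 6 + t ^ 4 / 8 * \<tau>\<^sup>2 < \<delta>" "0 < \<tau>"
    using eventually_happens'[OF trivial_limit_at_right_real] by blast
  have "(\<lambda>k. t\<^sup>2 * lindeberg_ratio k \<tau> + (\<bar>t\<bar> ^ 3 * \<tau> / 6 + t ^ 4 / 8 * (\<tau>\<^sup>2 + lindeberg_ratio k \<tau>)))
      \<longlonglongrightarrow> t\<^sup>2 * 0 + (\<bar>t\<bar> ^ 3 * \<tau> / 6 + t ^ 4 / 8 * (\<tau>\<^sup>2 + 0))"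
    by (intro tendsto_intros lindeberg_ratio_tendsto \<tau>) auto
  then have "\<forall>\<^sub>F k in sequentially.
      t\<^sup>2 * lindeberg_ratio k \<tau> + (\<bar>t\<bar> ^ 3 * \<tau> / 6 + t ^ 4 / 8 * (\<tau>\<^sup>2 + lindeberg_ratio k \<tau>)) < \<delta>"
    using \<tau> by (intro order_tendstoD(2)[of _ _ _ \<delta>]) (auto simp: algebra_simps)
  then show ?thesis
    using eventually_ge_at_top[of 1]
  proof eventually_elim
    case (elim k)
    then show ?case
      using char_increment_bound[of k _ \<tau> t] \<tau>(2) by (auto intro: le_less_trans)
  qed
qed

text \<open>
  The starting point \<open>j n\<close> of the increment may vary with its end point; only its asymptotic share
  \<open>v\<close> of the variance matters. The case \<open>v = 0\<close> of a degenerate limit is included, since passage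
  times can be arbitrarily close to the end.
\<close>

lemma increment_weak_conv:
  assumes r: "filterlim r at_top sequentially" and j: "\<And>n. j n \<le> r n"
    and v: "(\<lambda>n. 1 - B2 (j n) / B2 (r n)) \<longlonglongrightarrow> v" and "0 \<le> v"
  shows "weak_conv_m (\<lambda>n. distr M borel (\<lambda>\<omega>. (\<Sum>i\<in>{j n<..r n}. X i \<omega>) / B (r n)))
           (distr std_normal_distribution borel (\<lambda>z. sqrt v * z))"
proof (rule levy_continuity)
  have rv: "(\<lambda>\<omega>. (\<Sum>i\<in>{j n<..r n}. X i \<omega>) / B (r n)) \<in> borel_measurable M" for n
    by (intro borel_measurable_divide borel_measurable_sum X_measurable borel_measurable_const) auto
  then show "real_distribution (distr M borel (\<lambda>\<omega>. (\<Sum>i\<in>{j n<..r n}. X i \<omega>) / B (r n)))" for n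
    by (rule real_distribution_distr)
  show "real_distribution (distr std_normal_distribution borel (\<lambda>z. sqrt v * z))"
    by (intro prob_space.real_distribution_distr prob_space_normal_density) auto
  fix t :: real
  let ?c = "\<lambda>n. char (distr M borel (\<lambda>\<omega>. (\<Sum>i\<in>{j n<..r n}. X i \<omega>) / B (r n))) t"
  let ?e = "\<lambda>n. complex_of_real (exp (- (t\<^sup>2 / 2 * (1 - B2 (j n) / B2 (r n)))))"
  have "(\<lambda>n. ?c n - ?e n) \<longlonglongrightarrow> 0"
  proof (rule tendstoI)
    fix \<delta> :: real assume "0 < \<delta>"
    from char_increment_uniform[OF this, of t] r
    have "\<forall>\<^sub>F n in sequentially. \<forall>j\<le>r n.
      cmod (char (distr M borel (\<lambda>\<omega>. (\<Sum>i\<in>{j<..r n}. X i \<omega>) / B (r n))) t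
            - exp (- (t\<^sup>2 / 2 * (1 - B2 j / B2 (r n))))) < \<delta>"
      by (rule eventually_compose_filterlim)
    then show "\<forall>\<^sub>F n in sequentially. dist (?c n - ?e n) 0 < \<delta>"
      by eventually_elim (use j in auto)
  qed
  moreover have "?e \<longlonglongrightarrow> complex_of_real (exp (- (t\<^sup>2 / 2 * v)))"
    by (intro tendsto_intros v)
  ultimately have "(\<lambda>n. (?c n - ?e n) + ?e n) \<longlonglongrightarrow> 0 + complex_of_real (exp (- (t\<^sup>2 / 2 * v)))"
    by (rule tendsto_add)
  then show "?c \<longlonglongrightarrow> char (distr std_normal_distribution borel (\<lambda>z. sqrt v * z)) t"
    using \<open>0 \<le> v\<close> unfolding char_scaled_std_normal by (simp add: power_mult_distrib ac_simps)
qed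

theorem lindeberg_clt:
  "weak_conv_m (\<lambda>k. distr M borel (\<lambda>\<omega>. partial_sum X k \<omega> / B k)) std_normal_distribution"
proof -
  have "weak_conv_m (\<lambda>n. distr M borel (\<lambda>\<omega>. (\<Sum>i\<in>{0<..n}. X i \<omega>) / B n))
           (distr std_normal_distribution borel (\<lambda>z. sqrt 1 * z))"
    by (rule increment_weak_conv) (auto intro: filterlim_ident)
  moreover have "{0<..n} = {1..n}" for n :: nat by auto
  moreover have "distr std_normal_distribution borel (\<lambda>z. z) = std_normal_distribution"
    by (rule distr_id2) simp
  ultimately show ?thesis
    by (simp add: partial_sum_def)
qed

text \<open>
  This is the asymptotic symmetry of the increments that the reflection argument uses, uniformly in
  their starting point. Otherwise some sequence of increments would violate it; a subsequence has
  converging variance shares, hence a centred normal limit, under which odd functions have mean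
  zero.
\<close>

lemma increment_odd_uniform:
  fixes h :: "real \<Rightarrow> real"
  assumes h: "\<And>x. isCont h x" "\<And>x. \<bar>h x\<bar> \<le> 1" and odd: "\<And>x. h (- x) = - h x" and "0 < \<delta>"
  shows "\<forall>\<^sub>F k in sequentially. \<forall>j\<le>k.
    \<bar>expectation (\<lambda>\<omega>. h ((\<Sum>i\<in>{j<..k}. X i \<omega>) / B k))\<bar> < \<delta>"
proof (rule ccontr)
  let ?E = "\<lambda>j k. expectation (\<lambda>\<omega>. h ((\<Sum>i\<in>{j<..k}. X i \<omega>) / B k))"
  have h_rv [measurable]: "h \<in> borel_measurable borel"
    using h(1) by (intro borel_measurable_continuous_onI continuous_at_imp_continuous_on) auto
  assume "\<not> ?thesis"
  then have "\<exists>k\<ge>n. \<exists>j\<le>k. \<not> \<bar>?E j k\<bar> < \<delta>" for n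
    by (auto simp: eventually_sequentially)
  then obtain k j where k: "\<And>n. k n \<ge> n" and j: "\<And>n. j n \<le> k n" and big: "\<And>n. \<not> \<bar>?E (j n) (k n)\<bar> < \<delta>"
    by metis
  have k_lim: "filterlim k at_top sequentially"
    by (rule filterlim_at_top_mono[OF filterlim_ident]) (auto simp: k)
  define w where "w n = 1 - B2 (j n) / B2 (k n)" for n
  have w: "w n \<in> {0..1}" for n
  proof (cases "k n \<ge> 1")
    case True
    have "0 \<le> B2 (j n)" using B2_mono[of 0 "j n"] by simp
    then show ?thesis
      using B2_mono[OF j[of n]] B2_pos[OF True] by (simp add: w_def divide_simps)
  next
    case False
    then have "k n = 0" "j n = 0" using j[of n] by auto
    then show ?thesis by (simp add: w_def)
  qed
  then obtain v r where v: "v \<in> {0..1}" and r: "strict_mono (r :: nat \<Rightarrow> nat)" and wr: "(w \<circ> r) \<longlonglongrightarrow> v"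
    using seq_compactE[OF compact_imp_seq_compact[OF compact_Icc[of 0 "1::real"]]] by metis
  have conv: "weak_conv_m (\<lambda>n. distr M borel (\<lambda>\<omega>. (\<Sum>i\<in>{j (r n)<..k (r n)}. X i \<omega>) / B (k (r n))))
           (distr std_normal_distribution borel (\<lambda>z. sqrt v * z))"
  proof (rule increment_weak_conv)
    show "filterlim (\<lambda>n. k (r n)) at_top sequentially"
      by (rule filterlim_compose[OF k_lim filterlim_subseq[OF r]])
    show "(\<lambda>n. 1 - B2 (j (r n)) / B2 (k (r n))) \<longlonglongrightarrow> v"
      using wr by (simp add: w_def comp_def)
  qed (use j v in auto)
  have rv: "(\<lambda>\<omega>. (\<Sum>i\<in>{j n<..k n}. X i \<omega>) / B (k n)) \<in> borel_measurable M" for n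
    by (intro borel_measurable_divide borel_measurable_sum X_measurable borel_measurable_const) auto
  have "(\<lambda>n. integral\<^sup>L (distr M borel (\<lambda>\<omega>. (\<Sum>i\<in>{j (r n)<..k (r n)}. X i \<omega>) / B (k (r n)))) h)
      \<longlonglongrightarrow> integral\<^sup>L (distr std_normal_distribution borel (\<lambda>z. sqrt v * z)) h"
  proof (rule weak_conv_imp_integral_bdd_continuous_conv[where B=1, OF _ _ conv])
    show "real_distribution (distr std_normal_distribution borel (\<lambda>z. sqrt v * z))"
      by (intro prob_space.real_distribution_distr prob_space_normal_density) auto
  qed (use h rv in auto)
  moreover have "integral\<^sup>L (distr std_normal_distribution borel (\<lambda>z. sqrt v * z)) h = 0"
  proof -
    let ?I = "\<integral>z. h (sqrt v * z) \<partial>std_normal_distribution"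
    have eq: "?I = (\<integral>z. std_normal_density z * h (sqrt v * z) \<partial>lborel)"
      by (subst integral_density) auto
    also have "\<dots> = (\<integral>z. std_normal_density (- z) * h (sqrt v * (- z)) \<partial>lborel)"
      using lborel_integral_real_affine[of "-1" "\<lambda>z. std_normal_density z * h (sqrt v * z)" 0] by simp
    also have "\<dots> = - ?I"
      unfolding eq by (simp add: odd std_normal_density_def)
    finally show ?thesis by (simp add: integral_distr)
  qed
  ultimately have "(\<lambda>n. ?E (j (r n)) (k (r n))) \<longlonglongrightarrow> 0"
    using rv by (simp add: integral_distr)
  then have "\<forall>\<^sub>F n in sequentially. \<bar>?E (j (r n)) (k (r n))\<bar> < \<delta>"
    using \<open>0 < \<delta>\<close> by (auto simp: tendsto_iff)
  with big show False
    by (auto simp: eventually_sequentially)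
qed

end

section \<open>An approximate reflection principle\<close>

lemma std_normal_singleton_null: "measure std_normal_distribution {x} = 0"
  by (simp add: measure_def emeasure_density)

lemma isCont_cdf_std_normal: "isCont (cdf std_normal_distribution) x"
proof -
  interpret real_distribution std_normal_distribution by (rule real_dist_normal_dist)
  show ?thesis by (simp add: isCont_cdf std_normal_singleton_null)
qed

lemma std_normal_symmetric: "distr std_normal_distribution borel uminus = std_normal_distribution"
proof (rule Levy_uniqueness)
  show "char (distr std_normal_distribution borel uminus) = char std_normal_distribution"
    using char_scaled_std_normal[of "-1"] by (auto simp: char_std_normal_distribution)
qed (auto intro!: prob_space.real_distribution_distr prob_space_normal_density real_dist_normal_dist)

lemma measure_std_normal_uminus:
  assumes [measurable]: "A \<in> sets borel"
  shows "measure std_normal_distribution (uminus -` A) = measure std_normal_distribution A"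
proof -
  have "measure std_normal_distribution A = measure (distr std_normal_distribution borel uminus) A"
    by (simp add: std_normal_symmetric)
  also have "\<dots> = measure std_normal_distribution (uminus -` A)"
    by (subst measure_distr) auto
  finally show ?thesis by simp
qed

lemma cdf_abs_normal:
  "cdf (distr std_normal_distribution borel abs) x
     = (if x < 0 then 0 else 1 - 2 * measure std_normal_distribution {x<..})"
proof -
  interpret N: real_distribution std_normal_distribution by (rule real_dist_normal_dist)
  have cdf: "cdf (distr std_normal_distribution borel abs) x = measure std_normal_distribution {z. \<bar>z\<bar> \<le> x}"
    unfolding cdf_def by (subst measure_distr) (auto simp: vimage_def)
  show ?thesis
  proof (cases "x < 0")
    case True
    then have "{z. \<bar>z\<bar> \<le> x} = {}" by auto
    then show ?thesis using True by (simp add: cdf)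
  next
    case False
    have "{z. \<bar>z\<bar> \<le> x} = UNIV - ({x<..} \<union> {..<-x})" by auto
    then have "measure std_normal_distribution {z. \<bar>z\<bar> \<le> x}
        = 1 - measure std_normal_distribution ({x<..} \<union> {..<-x})"
      using N.prob_compl[of "{x<..} \<union> {..<-x}"] by simp
    also have "measure std_normal_distribution ({x<..} \<union> {..<-x})
        = measure std_normal_distribution {x<..} + measure std_normal_distribution {..<-x}"
      using False by (intro N.finite_measure_Union) auto
    also have "{..<-x} = uminus -` {x<..}" by auto
    also have "measure std_normal_distribution (uminus -` {x<..}) = measure std_normal_distribution {x<..}"
      by (rule measure_std_normal_uminus) simp
    finally show ?thesis using False by (simp add: cdf)
  qed
qed

lemma abs_clip_diff_le:
  fixes a b :: real
  shows "\<bar>max (-1) (min 1 a) - max (-1) (min 1 b)\<bar> \<le> min 2 \<bar>a - b\<bar>"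
  by (auto simp: max_def min_def abs_if)

context lindeberg_sequence
begin

lemma partial_sum_measurable [measurable]: "partial_sum X k \<in> borel_measurable M"
  unfolding partial_sum_def by (intro borel_measurable_sum X_measurable) auto

lemma max_partial_sum_measurable [measurable]: "max_partial_sum X k \<in> borel_measurable M"
  unfolding max_partial_sum_def by (cases "k = 0") auto

lemma max_partial_sum_gt_iff:
  "k \<ge> 1 \<Longrightarrow> c < max_partial_sum X k \<omega> \<longleftrightarrow> (\<exists>j\<in>{1..k}. c < partial_sum X j \<omega>)"
  unfolding max_partial_sum_def by (auto simp: Max_gr_iff)

lemma partial_sum_split: "j \<le> k \<Longrightarrow> partial_sum X k \<omega> = partial_sum X j \<omega> + (\<Sum>i\<in>{j<..k}. X i \<omega>)"
proof -
  assume "j \<le> k"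
  then have "{1..k} = {1..j} \<union> {j<..k}" by auto
  then show ?thesis
    unfolding partial_sum_def by (subst sum.union_disjoint[symmetric]) auto
qed

definition first_passage :: "real \<Rightarrow> nat \<Rightarrow> 'a set" where
  "first_passage c j = {\<omega> \<in> space M. c < partial_sum X j \<omega> \<and> (\<forall>i\<in>{1..<j}. partial_sum X i \<omega> \<le> c)}"

lemma first_passage_sets [measurable]: "first_passage c j \<in> sets M"
  unfolding first_passage_def by measurable

lemma first_passage_disjoint: "disjoint_family_on (first_passage c) {1..k}"
unfolding disjoint_family_on_def
proof (intro ballI impI)
  fix i j assume *: "i \<in> {1..k}" "j \<in> {1..k}" "i \<noteq> j"
  then consider "i \<in> {1..<j}" | "j \<in> {1..<i}" by force
  then show "first_passage c i \<inter> first_passage c j = {}"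
    by cases (force simp: first_passage_def)+
qed

lemma UN_first_passage:
  assumes "k \<ge> 1"
  shows "(\<Union>j\<in>{1..k}. first_passage c j) = {\<omega> \<in> space M. c < max_partial_sum X k \<omega>}"
proof safe
  fix \<omega> j assume j: "j \<in> {1..k}" and \<omega>: "\<omega> \<in> first_passage c j"
  then show "\<omega> \<in> space M" "c < max_partial_sum X k \<omega>"
    using max_partial_sum_gt_iff[OF assms, of c \<omega>] by (auto simp: first_passage_def)
next
  fix \<omega> assume \<omega>: "\<omega> \<in> space M" "c < max_partial_sum X k \<omega>"
  let ?P = "\<lambda>j. 1 \<le> j \<and> j \<le> k \<and> c < partial_sum X j \<omega>"
  have "\<exists>j. ?P j"
    using \<omega> max_partial_sum_gt_iff[OF assms, of c \<omega>] by auto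
  then have P: "?P (LEAST j. ?P j)" by (rule LeastI_ex)
  have "partial_sum X i \<omega> \<le> c" if "i \<in> {1..<LEAST j. ?P j}" for i
    using not_less_Least[of i ?P] that P by force
  then have "\<omega> \<in> first_passage c (LEAST j. ?P j)"
    using P \<omega> by (simp add: first_passage_def)
  with P show "\<omega> \<in> (\<Union>j\<in>{1..k}. first_passage c j)"
    by (intro UN_I[of "LEAST j. ?P j"]) auto
qed

text \<open>
  The event that the level is first exceeded at time \<open>j\<close> depends on the first \<open>j\<close> summands only.
\<close>

lemma first_passage_indep_increment:
  fixes h :: "real \<Rightarrow> real"
  assumes [measurable]: "h \<in> borel_measurable borel" and h: "\<And>x. \<bar>h x\<bar> \<le> 1" and jk: "j \<le> k"
  shows "expectation (\<lambda>\<omega>. indicator (first_passage c j) \<omega> * h ((\<Sum>i\<in>{j<..k}. X i \<omega>) / B k))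
     = prob (first_passage c j) * expectation (\<lambda>\<omega>. h ((\<Sum>i\<in>{j<..k}. X i \<omega>) / B k))"
proof -
  let ?N = "\<lambda>A. PiM A (\<lambda>_. borel :: real measure)"
  let ?F = "\<lambda>f::nat \<Rightarrow> real. indicator {f. c < (\<Sum>l=1..j. f l) \<and> (\<forall>i\<in>{1..<j}. (\<Sum>l=1..i. f l) \<le> c)} f :: real"
  let ?G = "\<lambda>f::nat \<Rightarrow> real. h ((\<Sum>i\<in>{j<..k}. f i) / B k)"
  have rv: "(\<lambda>\<omega>. (\<Sum>i\<in>{j<..k}. X i \<omega>) / B k) \<in> borel_measurable M"
    by (intro borel_measurable_divide borel_measurable_sum X_measurable borel_measurable_const) auto
  have "indep_var (?N {1..j}) (\<lambda>\<omega>. restrict (\<lambda>i. X i \<omega>) {1..j}) (?N {j<..k}) (\<lambda>\<omega>. restrict (\<lambda>i. X i \<omega>) {j<..k})"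
    by (rule indep_var_restrict[OF indep]) auto
  moreover have "?F \<in> borel_measurable (?N {1..j})"
  proof -
    have 1: "(\<lambda>f. \<Sum>l=1..i. f l) \<in> borel_measurable (?N {1..j})" if "i \<le> j" for i
      using that by (intro borel_measurable_sum measurable_component_singleton) auto
    have "Measurable.pred (?N {1..j}) (\<lambda>f. c < (\<Sum>l=1..j. f l) \<and> (\<forall>i\<in>{1..<j}. (\<Sum>l=1..i. f l) \<le> c))"
      by (intro pred_intros_logic pred_intros_finite borel_measurable_pred_less borel_measurable_le
            borel_measurable_const 1) (auto intro!: 1 borel_measurable_le)
    then show ?thesis
      by (simp add: indicator_def[abs_def] measurable_If)
  qed
  moreover have "?G \<in> borel_measurable (?N {j<..k})"
  proof -
    have "(\<lambda>f. (\<Sum>i\<in>{j<..k}. f i) / B k) \<in> borel_measurable (?N {j<..k})"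
      by (intro borel_measurable_divide borel_measurable_sum measurable_component_singleton) auto
    then show ?thesis by measurable
  qed
  ultimately have "indep_var borel (?F \<circ> (\<lambda>\<omega>. restrict (\<lambda>i. X i \<omega>) {1..j})) borel (?G \<circ> (\<lambda>\<omega>. restrict (\<lambda>i. X i \<omega>) {j<..k}))"
    by (rule indep_var_compose)
  then have ind: "indep_var borel (\<lambda>\<omega>. ?F (restrict (\<lambda>i. X i \<omega>) {1..j})) borel (\<lambda>\<omega>. h ((\<Sum>i\<in>{j<..k}. X i \<omega>) / B k))"
    by (simp add: comp_def)
  have F_eq: "?F (restrict (\<lambda>i. X i \<omega>) {1..j}) = indicator (first_passage c j) \<omega>" if "\<omega> \<in> space M" for \<omega>
    using that by (auto simp: first_passage_def partial_sum_def indicator_def)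
  have "expectation (\<lambda>\<omega>. indicator (first_passage c j) \<omega> * h ((\<Sum>i\<in>{j<..k}. X i \<omega>) / B k))
      = expectation (\<lambda>\<omega>. ?F (restrict (\<lambda>i. X i \<omega>) {1..j}) * h ((\<Sum>i\<in>{j<..k}. X i \<omega>) / B k))"
    by (rule Bochner_Integration.integral_cong[OF refl]) (simp only: F_eq)
  also have "\<dots> = expectation (\<lambda>\<omega>. ?F (restrict (\<lambda>i. X i \<omega>) {1..j})) * expectation (\<lambda>\<omega>. h ((\<Sum>i\<in>{j<..k}. X i \<omega>) / B k))"
  proof (rule indep_var_lebesgue_integral[OF ind])
    show "integrable M (\<lambda>\<omega>. ?F (restrict (\<lambda>i. X i \<omega>) {1..j}))"
      using indep_var_rv1[OF ind] by (intro integrable_const_bound[where B=1]) auto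
    show "integrable M (\<lambda>\<omega>. h ((\<Sum>i\<in>{j<..k}. X i \<omega>) / B k))"
      using indep_var_rv2[OF ind] h by (intro integrable_const_bound[where B=1]) auto
  qed
  also have "expectation (\<lambda>\<omega>. ?F (restrict (\<lambda>i. X i \<omega>) {1..j})) = expectation (indicator (first_passage c j))"
    by (rule Bochner_Integration.integral_cong[OF refl]) (simp only: F_eq)
  finally show ?thesis by simp
qed

text \<open>
  Let \<open>Y\<close> be the scaled distance of the final sum from the level \<open>x\<close>, and let \<open>h\<close> be a Lipschitz
  approximation of the sign function. If the maximum exceeds the level, then \<open>Y\<close> is the overshoot
  at the passage time plus the increment after it. Replacing \<open>h Y\<close> by \<open>h\<close> of this increment costs
  at most \<open>\<rho> / \<epsilon>\<close> as long as the overshoot, which is bounded by the summand at the passage time, is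
  less than \<open>\<rho>\<close>; larger summands are controlled by the Lindeberg ratio. By independence and
  near symmetry of the increment, the mean of \<open>h Y\<close> on the event that the level is exceeded is at
  most \<open>\<eta>\<close> in modulus, up to these errors. On the other hand \<open>h Y\<close> is the sign of \<open>Y\<close> unless
  \<open>\<bar>Y\<bar> \<le> \<epsilon>\<close>, and the mean of this sign on the event is the difference on the left-hand side, because
  the event contains the event \<open>Y > 0\<close>.
\<close>

lemma reflection_estimate:
  assumes k: "k \<ge> 1" and x: "0 \<le> x" and \<epsilon>: "0 < \<epsilon>" and \<rho>: "0 < \<rho>"
  defines "h \<equiv> \<lambda>y. max (-1) (min 1 (y / \<epsilon>))"
  assumes \<eta>: "\<And>j. j \<le> k \<Longrightarrow> \<bar>expectation (\<lambda>\<omega>. h ((\<Sum>i\<in>{j<..k}. X i \<omega>) / B k))\<bar> \<le> \<eta>"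
  shows "\<bar>2 * \<P>(\<omega> in M. x < partial_sum X k \<omega> / B k) - \<P>(\<omega> in M. x < max_partial_sum X k \<omega> / B k)\<bar>
    \<le> \<eta> + \<rho> / \<epsilon> + 2 / \<rho>\<^sup>2 * lindeberg_ratio k \<rho> + \<P>(\<omega> in M. \<bar>partial_sum X k \<omega> / B k - x\<bar> \<le> \<epsilon>)"
proof -
  have B: "0 < B k" using B2_pos[OF k] by simp
  define c where "c = x * B k"
  define A where "A = first_passage c"
  define E where "E = {\<omega> \<in> space M. x < max_partial_sum X k \<omega> / B k}"
  define Y where "Y \<omega> = partial_sum X k \<omega> / B k - x" for \<omega>
  define T where "T j \<omega> = (\<Sum>i\<in>{j<..k}. X i \<omega>) / B k" for j \<omega>
  have [measurable]: "h \<in> borel_measurable borel"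
    unfolding h_def by measurable
  have h1: "\<bar>h y\<bar> \<le> 1" for y by (auto simp: h_def)
  have hdiff: "\<bar>h a - h b\<bar> \<le> min 2 (\<bar>a - b\<bar> / \<epsilon>)" for a b
    using abs_clip_diff_le[of "a / \<epsilon>" "b / \<epsilon>"] \<epsilon>
    by (simp add: h_def diff_divide_distrib[symmetric])
  have Y_rv [measurable]: "Y \<in> borel_measurable M"
    unfolding Y_def[abs_def] by measurable
  have T_rv [measurable]: "T j \<in> borel_measurable M" for j
    unfolding T_def[abs_def]
    by (intro borel_measurable_divide borel_measurable_sum X_measurable borel_measurable_const) auto
  have A_sets [measurable]: "A j \<in> sets M" for j
    by (simp add: A_def)
  have E_UN: "E = (\<Union>j\<in>{1..k}. A j)"
    unfolding A_def UN_first_passage[OF k] E_def c_def using B by (simp add: pos_less_divide_eq)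
  have E_sets [measurable]: "E \<in> sets M" unfolding E_def by measurable
  have disj: "disjoint_family_on A {1..k}"
    unfolding A_def by (rule first_passage_disjoint)
  have ind_E: "indicator E \<omega> = (\<Sum>j=1..k. indicator (A j) \<omega> :: real)" for \<omega>
    unfolding E_UN by (rule indicator_UN_disjoint) (use disj in auto)
  have prob_A: "(\<Sum>j=1..k. prob (A j)) \<le> 1"
  proof -
    have "(\<Sum>j=1..k. prob (A j)) = prob E"
      unfolding E_UN by (rule finite_measure_finite_Union[symmetric]) (use disj in auto)
    then show ?thesis by simp
  qed

  have each: "\<bar>expectation (\<lambda>\<omega>. indicator (A j) \<omega> * h (Y \<omega>))\<bar>
      \<le> (\<eta> + \<rho> / \<epsilon>) * prob (A j) + 2 / \<rho>\<^sup>2 * (tail_moment k \<rho> j / B2 k)" if j: "j \<in> {1..k}" for j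
  proof -
    have j1: "j \<ge> 1" "j \<le> k" using j by auto
    have int_A: "integrable M (indicat_real (A j))"
      by (intro integrable_const_bound[where B=1]) auto
    have int_ind: "integrable M (\<lambda>\<omega>. indicator (A j) \<omega> * g \<omega>)"
      if [measurable]: "g \<in> borel_measurable M" and "\<And>\<omega>. \<bar>g \<omega>\<bar> \<le> 1" for g :: "'a \<Rightarrow> real"
      using that by (intro integrable_const_bound[where B=1]) (auto simp: indicator_def)
    have "expectation (\<lambda>\<omega>. indicator (A j) \<omega> * h (Y \<omega>)) - expectation (\<lambda>\<omega>. indicator (A j) \<omega> * h (T j \<omega>))
        = expectation (\<lambda>\<omega>. indicator (A j) \<omega> * h (Y \<omega>) - indicator (A j) \<omega> * h (T j \<omega>))"
      by (rule Bochner_Integration.integral_diff[symmetric]) (auto intro!: int_ind h1)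
    also have "\<bar>\<dots>\<bar> \<le> expectation (\<lambda>\<omega>. \<bar>indicator (A j) \<omega> * h (Y \<omega>) - indicator (A j) \<omega> * h (T j \<omega>)\<bar>)"
      by (rule integral_abs_bound)
    also have "\<dots> \<le> expectation (\<lambda>\<omega>. \<rho> / \<epsilon> * indicator (A j) \<omega>
        + 2 / (\<rho>\<^sup>2 * B2 k) * (indicator {x. \<bar>x\<bar> \<ge> \<rho> * B k} (X j \<omega>) * (X j \<omega>)\<^sup>2))"
    proof (intro integral_mono)
      fix \<omega> assume \<omega>: "\<omega> \<in> space M"
      show "\<bar>indicator (A j) \<omega> * h (Y \<omega>) - indicator (A j) \<omega> * h (T j \<omega>)\<bar>
        \<le> \<rho> / \<epsilon> * indicator (A j) \<omega>
        + 2 / (\<rho>\<^sup>2 * B2 k) * (indicator {x. \<bar>x\<bar> \<ge> \<rho> * B k} (X j \<omega>) * (X j \<omega>)\<^sup>2)"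
      proof (cases "\<omega> \<in> A j")
        case False
        then show ?thesis using B by simp
      next
        case True
        have lo: "c < partial_sum X j \<omega>" using True by (simp add: A_def first_passage_def)
        \<comment> \<open>For \<open>j = 1\<close> this is where \<open>0 \<le> x\<close> enters: the empty sum does not exceed the level.\<close>
        have "partial_sum X (j - 1) \<omega> \<le> c"
        proof (cases "j = 1")
          case True
          then show ?thesis using x B by (simp add: partial_sum_def c_def)
        next
          case False
          then have "j - 1 \<in> {1..<j}" using j1 by auto
          then show ?thesis using \<open>\<omega> \<in> A j\<close> by (auto simp: A_def first_passage_def)
        qed
        moreover have "partial_sum X j \<omega> = partial_sum X (j - 1) \<omega> + X j \<omega>"
          using j1 by (cases j) (auto simp: partial_sum_def)
        ultimately have over: "partial_sum X j \<omega> - c \<le> \<bar>X j \<omega>\<bar>" by simp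
        have "Y \<omega> - T j \<omega> = (partial_sum X j \<omega> - c) / B k"
          using B partial_sum_split[OF j1(2), of \<omega>] by (simp add: Y_def T_def c_def field_simps)
        then have YT: "\<bar>Y \<omega> - T j \<omega>\<bar> \<le> \<bar>X j \<omega>\<bar> / B k"
          using over lo B by (simp add: divide_right_mono)
        show ?thesis
        proof (cases "\<bar>X j \<omega>\<bar> \<ge> \<rho> * B k")
          case big: True
          have "(\<rho> * B k)\<^sup>2 \<le> \<bar>X j \<omega>\<bar>\<^sup>2"
            using big \<rho> B by (intro power_mono) auto
          then have "\<rho>\<^sup>2 * B2 k \<le> (X j \<omega>)\<^sup>2"
            using B by (simp add: power_mult_distrib)
          then have "2 \<le> 2 / (\<rho>\<^sup>2 * B2 k) * (X j \<omega>)\<^sup>2"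
            using \<rho> B by (simp add: pos_le_divide_eq)
          moreover have "\<bar>h (Y \<omega>) - h (T j \<omega>)\<bar> \<le> 2"
            using hdiff[of "Y \<omega>" "T j \<omega>"] by simp
          moreover have "0 \<le> \<rho> / \<epsilon>" using \<rho> \<epsilon> by simp
          ultimately show ?thesis using True big by simp
        next
          case small: False
          have "\<bar>h (Y \<omega>) - h (T j \<omega>)\<bar> \<le> \<bar>Y \<omega> - T j \<omega>\<bar> / \<epsilon>"
            using hdiff[of "Y \<omega>" "T j \<omega>"] by simp
          also have "\<dots> \<le> (\<bar>X j \<omega>\<bar> / B k) / \<epsilon>"
            using YT \<epsilon> by (intro divide_right_mono) auto
          also have "\<dots> \<le> \<rho> / \<epsilon>"
            using small B \<epsilon> by (intro divide_right_mono) (auto simp: pos_divide_le_eq)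
          finally show ?thesis using True small by simp
        qed
      qed
    qed (use j1 in \<open>auto intro!: tail_moment_integrable int_A int_ind h1 integrable_abs Bochner_Integration.integrable_diff
          Bochner_Integration.integrable_add integrable_mult_right simp del: times_divide_eq_left times_divide_eq_right\<close>)
    also have "\<dots> = \<rho> / \<epsilon> * prob (A j) + 2 / (\<rho>\<^sup>2 * B2 k) * tail_moment k \<rho> j"
      using j1 by (subst Bochner_Integration.integral_add)
        (auto intro!: integrable_mult_right tail_moment_integrable int_A simp: tail_moment_def
          simp del: times_divide_eq_left times_divide_eq_right)
    finally have 1: "\<bar>expectation (\<lambda>\<omega>. indicator (A j) \<omega> * h (Y \<omega>)) - expectation (\<lambda>\<omega>. indicator (A j) \<omega> * h (T j \<omega>))\<bar>
        \<le> \<rho> / \<epsilon> * prob (A j) + 2 / (\<rho>\<^sup>2 * B2 k) * tail_moment k \<rho> j" .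
    have "\<bar>expectation (\<lambda>\<omega>. indicator (A j) \<omega> * h (T j \<omega>))\<bar> = prob (A j) * \<bar>expectation (\<lambda>\<omega>. h (T j \<omega>))\<bar>"
      using first_passage_indep_increment[of h j k c] h1 j1 by (simp add: A_def T_def abs_mult)
    also have "\<dots> \<le> prob (A j) * \<eta>"
      using \<eta>[OF j1(2)] by (intro mult_left_mono) (auto simp: T_def)
    finally show ?thesis using 1 by (simp add: algebra_simps)
  qed

  have "expectation (\<lambda>\<omega>. indicator E \<omega> * h (Y \<omega>)) = (\<Sum>j=1..k. expectation (\<lambda>\<omega>. indicator (A j) \<omega> * h (Y \<omega>)))"
  proof -
    have "integrable M (\<lambda>\<omega>. indicator (A j) \<omega> * h (Y \<omega>))" for j
      using h1 by (intro integrable_const_bound[where B=1]) (auto simp: indicator_def)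
    then show ?thesis
      unfolding ind_E sum_distrib_right by (intro Bochner_Integration.integral_sum)
  qed
  also have "\<bar>\<dots>\<bar> \<le> (\<Sum>j=1..k. (\<eta> + \<rho> / \<epsilon>) * prob (A j) + 2 / \<rho>\<^sup>2 * (tail_moment k \<rho> j / B2 k))"
    by (rule order_trans[OF sum_abs]) (intro sum_mono each)
  also have "\<dots> = (\<eta> + \<rho> / \<epsilon>) * (\<Sum>j=1..k. prob (A j)) + 2 / \<rho>\<^sup>2 * lindeberg_ratio k \<rho>"
    by (simp add: lindeberg_ratio_def sum.distrib sum_distrib_left sum_divide_distrib)
  also have "\<dots> \<le> (\<eta> + \<rho> / \<epsilon>) * 1 + 2 / \<rho>\<^sup>2 * lindeberg_ratio k \<rho>"
  proof -
    have "0 \<le> \<eta>" using \<eta>[of k] by (meson abs_ge_zero order_refl order_trans)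
    then show ?thesis using prob_A \<rho> \<epsilon> by (intro add_right_mono mult_left_mono) auto
  qed
  finally have 2: "\<bar>expectation (\<lambda>\<omega>. indicator E \<omega> * h (Y \<omega>))\<bar> \<le> \<eta> + \<rho> / \<epsilon> + 2 / \<rho>\<^sup>2 * lindeberg_ratio k \<rho>"
    by simp

  have prob_eq: "\<P>(\<omega> in M. x < partial_sum X k \<omega> / B k) = expectation (indicator {\<omega> \<in> space M. 0 < Y \<omega>})"
    "\<P>(\<omega> in M. x < max_partial_sum X k \<omega> / B k) = expectation (indicator E)"
    "\<P>(\<omega> in M. \<bar>partial_sum X k \<omega> / B k - x\<bar> \<le> \<epsilon>) = expectation (indicator {\<omega> \<in> space M. \<bar>Y \<omega>\<bar> \<le> \<epsilon>})"
    by (simp_all add: Y_def E_def)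
  let ?i = "\<lambda>A. indicator A :: 'a \<Rightarrow> real"
  have int: "integrable M (?i {\<omega> \<in> space M. 0 < Y \<omega>})" "integrable M (?i E)"
      "integrable M (?i {\<omega> \<in> space M. \<bar>Y \<omega>\<bar> \<le> \<epsilon>})"
    by (auto intro!: integrable_const_bound[where B=1])
  have intE: "integrable M (\<lambda>\<omega>. indicator E \<omega> * h (Y \<omega>))"
    using h1 by (intro integrable_const_bound[where B=1]) (auto simp: indicator_def)
  have "2 * \<P>(\<omega> in M. x < partial_sum X k \<omega> / B k) - \<P>(\<omega> in M. x < max_partial_sum X k \<omega> / B k)
      - expectation (\<lambda>\<omega>. indicator E \<omega> * h (Y \<omega>))
     = expectation (\<lambda>\<omega>. 2 * ?i {\<omega> \<in> space M. 0 < Y \<omega>} \<omega> - ?i E \<omega> - indicator E \<omega> * h (Y \<omega>))"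
    unfolding prob_eq using int intE by simp
  also have "\<bar>\<dots>\<bar> \<le> expectation (\<lambda>\<omega>. \<bar>2 * ?i {\<omega> \<in> space M. 0 < Y \<omega>} \<omega> - ?i E \<omega> - indicator E \<omega> * h (Y \<omega>)\<bar>)"
    by (rule integral_abs_bound)
  also have "\<dots> \<le> expectation (?i {\<omega> \<in> space M. \<bar>Y \<omega>\<bar> \<le> \<epsilon>})"
  proof (intro integral_mono)
    fix \<omega> assume \<omega>: "\<omega> \<in> space M"
    \<comment> \<open>The final sum is one of the sums over which the maximum is taken.\<close>
    have YE: "\<omega> \<in> E" if "0 < Y \<omega>"
    proof -
      have "x * B k < partial_sum X k \<omega>"
        using that B by (simp add: Y_def pos_less_divide_eq)
      then have "x * B k < max_partial_sum X k \<omega>"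
        using k by (subst max_partial_sum_gt_iff) auto
      then show ?thesis using B \<omega> by (simp add: E_def pos_less_divide_eq)
    qed
    have h_ge: "h (Y \<omega>) = 1" if "\<epsilon> < Y \<omega>"
      using that \<epsilon> by (simp add: h_def)
    have h_le: "h (Y \<omega>) = -1" if "Y \<omega> < - \<epsilon>"
      using that \<epsilon> by (simp add: h_def min_def max_def divide_le_eq le_divide_eq)
    have h_pos: "0 \<le> h (Y \<omega>)" if "0 < Y \<omega>"
      using that \<epsilon> by (simp add: h_def le_max_iff_disj)
    have h_neg: "h (Y \<omega>) \<le> 0" if "Y \<omega> \<le> 0"
      using that \<epsilon> by (simp add: h_def divide_le_0_iff min_le_iff_disj)
    show "\<bar>2 * ?i {\<omega> \<in> space M. 0 < Y \<omega>} \<omega> - ?i E \<omega> - indicator E \<omega> * h (Y \<omega>)\<bar>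
        \<le> ?i {\<omega> \<in> space M. \<bar>Y \<omega>\<bar> \<le> \<epsilon>} \<omega>"
      using YE h_ge h_le h_pos h_neg h1[of "Y \<omega>"] \<omega> \<epsilon>
      by (cases "0 < Y \<omega>"; cases "\<bar>Y \<omega>\<bar> \<le> \<epsilon>") (auto simp: indicator_def abs_le_iff)
  qed (use int intE in auto)
  finally show ?thesis
    using 2 unfolding prob_eq by linarith
qed

end

section \<open>Random indices and normal mixtures\<close>

lemma weak_conv_m_continuous_map:
  assumes \<mu>: "\<And>n. real_distribution (\<mu> n)" and \<nu>: "real_distribution \<nu>" and conv: "weak_conv_m \<mu> \<nu>"
    and g: "\<And>x::real. isCont (g :: real \<Rightarrow> real) x"
  shows "weak_conv_m (\<lambda>n. distr (\<mu> n) borel g) (distr \<nu> borel g)"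
proof -
  have g_rv [measurable]: "g \<in> borel_measurable borel"
    using g by (intro borel_measurable_continuous_onI continuous_at_imp_continuous_on) auto
  interpret \<mu>: real_distribution "\<mu> n" for n by fact
  interpret \<nu>: real_distribution \<nu> by fact
  show ?thesis
  proof (rule integral_bdd_continuous_conv_imp_weak_conv)
    fix f :: "real \<Rightarrow> real" assume f: "\<And>x. isCont f x" "\<And>x. \<bar>f x\<bar> \<le> 1"
    have [measurable]: "f \<in> borel_measurable borel"
      using f by (intro borel_measurable_continuous_onI continuous_at_imp_continuous_on) auto
    have "(\<lambda>n. integral\<^sup>L (\<mu> n) (\<lambda>x. f (g x))) \<longlonglongrightarrow> integral\<^sup>L \<nu> (\<lambda>x. f (g x))"
      using f g by (intro weak_conv_imp_integral_bdd_continuous_conv[where B=1, OF \<mu> \<nu> conv])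
        (auto intro: isCont_o2)
    then show "(\<lambda>n. integral\<^sup>L (distr (\<mu> n) borel g) f) \<longlonglongrightarrow> integral\<^sup>L (distr \<nu> borel g) f"
      by (simp add: integral_distr)
  qed auto
qed

text \<open>
  Polya's theorem: distribution functions are monotone, so convergence at the \<open>m\<close>-quantiles of a
  continuous limit controls the distance everywhere up to \<open>3 / m\<close>.
\<close>

lemma weak_conv_m_uniform:
  assumes \<mu>: "\<And>n. real_distribution (\<mu> n)" and \<nu>: "real_distribution \<nu>" and conv: "weak_conv_m \<mu> \<nu>"
    and cont: "\<And>x. isCont (cdf \<nu>) x" and \<delta>: "0 < \<delta>"
  shows "\<forall>\<^sub>F n in sequentially. \<forall>x. \<bar>cdf (\<mu> n) x - cdf \<nu> x\<bar> < \<delta>"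
proof -
  interpret \<mu>: real_distribution "\<mu> n" for n by fact
  interpret \<nu>: real_distribution \<nu> by fact
  let ?F = "cdf \<nu>"
  obtain m :: nat where m: "m > 0" "3 / real m < \<delta>"
  proof -
    obtain m :: nat where m: "m > 0" "inverse (real m) < \<delta> / 3"
      using ex_inverse_of_nat_less[of "\<delta> / 3"] \<delta> by auto
    then have "3 / real m < \<delta>" by (simp add: inverse_eq_divide)
    with m that show ?thesis by blast
  qed
  have "\<exists>q. ?F q = real i / real m" if i: "0 < i" "i < m" for i
  proof -
    have "\<forall>\<^sub>F x in at_bot. ?F x < real i / real m"
      using i by (intro order_tendstoD(2)[OF \<nu>.cdf_lim_at_bot]) simp
    then obtain a where a: "\<And>x. x \<le> a \<Longrightarrow> ?F x < real i / real m"
      unfolding eventually_at_bot_linorder by auto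
    have "\<forall>\<^sub>F x in at_top. real i / real m < ?F x"
      using i by (intro order_tendstoD(1)[OF \<nu>.cdf_lim_at_top_prob]) simp
    then obtain b where b: "\<And>x. x \<ge> b \<Longrightarrow> real i / real m < ?F x"
      unfolding eventually_at_top_linorder by auto
    have "\<exists>x\<ge>a. x \<le> max a b \<and> ?F x = real i / real m"
      using a[of a] b[of "max a b"] cont by (intro IVT) auto
    then show ?thesis by blast
  qed
  then obtain q where q: "\<And>i. 0 < i \<Longrightarrow> i < m \<Longrightarrow> ?F (q i) = real i / real m"
    by metis
  have "\<forall>\<^sub>F n in sequentially. \<forall>i\<in>{0<..<m}. \<bar>cdf (\<mu> n) (q i) - ?F (q i)\<bar> < 1 / real m"
  proof (rule eventually_ball_finite, safe)
    fix i
    have "(\<lambda>n. cdf (\<mu> n) (q i)) \<longlonglongrightarrow> ?F (q i)"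
      using conv cont by (simp add: weak_conv_m_def weak_conv_def)
    then show "\<forall>\<^sub>F n in sequentially. \<bar>cdf (\<mu> n) (q i) - ?F (q i)\<bar> < 1 / real m"
      using m by (auto simp: tendsto_iff dist_real_def)
  qed
  then show ?thesis
  proof eventually_elim
    case (elim n)
    show ?case
    proof
      fix x
      define i where "i = nat \<lfloor>?F x * real m\<rfloor>"
      have F: "0 \<le> ?F x" "?F x \<le> 1"
        using \<nu>.cdf_bounded_prob by (auto simp: \<nu>.cdf_nonneg)
      have i: "real i \<le> ?F x * real m" "?F x * real m < real i + 1"
        unfolding i_def using F by (simp_all add: of_nat_nat)
      have iF: "real i / real m \<le> ?F x" "?F x < (real i + 1) / real m"
        using i m by (simp_all add: pos_divide_le_eq pos_less_divide_eq)
      \<comment> \<open>The neighbouring quantiles \<open>q (i + 1)\<close> and \<open>q (i - 1)\<close> enclose \<open>x\<close>; where one of them does not exist,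
        the bounds 0 and 1 of a distribution function take its place. The index \<open>i - 1\<close> is used below since
        \<open>q i\<close> itself may lie to the right of \<open>x\<close> when \<open>i / m\<close> is attained at \<open>x\<close>.\<close>
      have hi: "cdf (\<mu> n) x \<le> (real i + 2) / real m"
      proof (cases "i + 1 < m")
        case True
        then have q': "?F (q (i + 1)) = (real i + 1) / real m" using q[of "i + 1"] by simp
        then have "x \<le> q (i + 1)"
          using iF(2) \<nu>.cdf_nondecreasing[of "q (i + 1)" x] by force
        then have "cdf (\<mu> n) x \<le> cdf (\<mu> n) (q (i + 1))"
          by (rule \<mu>.cdf_nondecreasing)
        moreover have "\<bar>cdf (\<mu> n) (q (i + 1)) - ?F (q (i + 1))\<bar> < 1 / real m"
          using elim True by auto
        moreover have "(real i + 2) / real m = (real i + 1) / real m + 1 / real m"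
          by (simp add: add_divide_distrib)
        ultimately show ?thesis using q' by linarith
      next
        case False
        then have "1 \<le> (real i + 2) / real m" using m by (simp add: pos_le_divide_eq)
        then show ?thesis using \<mu>.cdf_bounded_prob[of n x] by simp
      qed
      have lo: "(real i - 2) / real m \<le> cdf (\<mu> n) x"
      proof (cases "i \<ge> 2")
        case True
        have "i \<le> m"
          using i(1) F(2) m by (metis mult_left_le_one_le of_nat_0_le_iff of_nat_le_iff order_trans F(1))
        then have "?F (q (i - 1)) = (real i - 1) / real m" using True q[of "i - 1"] by (simp add: of_nat_diff)
        moreover have "(real i - 1) / real m < real i / real m"
          using m by (simp add: divide_strict_right_mono)
        ultimately have q': "?F (q (i - 1)) = (real i - 1) / real m" "q (i - 1) \<le> x"
          using iF(1) \<nu>.cdf_nondecreasing[of x "q (i - 1)"] by force+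
        then have "cdf (\<mu> n) (q (i - 1)) \<le> cdf (\<mu> n) x"
          by (intro \<mu>.cdf_nondecreasing)
        moreover have "\<bar>cdf (\<mu> n) (q (i - 1)) - ?F (q (i - 1))\<bar> < 1 / real m"
          using elim True \<open>i \<le> m\<close> by auto
        moreover have "(real i - 2) / real m = (real i - 1) / real m - 1 / real m"
          by (simp add: diff_divide_distrib[symmetric])
        ultimately show ?thesis using q' by linarith
      next
        case False
        then have "(real i - 2) / real m \<le> 0" using m by (simp add: divide_le_0_iff)
        then show ?thesis using \<mu>.cdf_nonneg[of n x] by simp
      qed
      define a w where "a = real i / real m" and "w = 1 / real m"
      have "cdf (\<mu> n) x \<le> a + 2 * w" "a - 2 * w \<le> cdf (\<mu> n) x" "a \<le> ?F x" "?F x < a + w" "3 * w < \<delta>" "0 < w"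
        using hi lo iF m by (simp_all add: a_def w_def add_divide_distrib diff_divide_distrib)
      then show "\<bar>cdf (\<mu> n) x - ?F x\<bar> < \<delta>"
        by linarith
    qed
  qed
qed

text \<open>
  Decomposition according to the value of the random index, as a series so that both sides of
  \<open>prob_random_index\<close> can be compared term by term.
\<close>

lemma (in prob_space) sums_expectation_random_index:
  fixes f :: "nat \<Rightarrow> 'a \<Rightarrow> real"
  assumes [measurable]: "K \<in> measurable M (count_space UNIV)" "\<And>k. f k \<in> borel_measurable M"
    and bd: "\<And>k \<omega>. \<bar>f k \<omega>\<bar> \<le> 1"
  shows "(\<lambda>k. expectation (\<lambda>\<omega>. indicator {k} (K \<omega>) * f k \<omega>)) sums expectation (\<lambda>\<omega>. f (K \<omega>) \<omega>)"
proof -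
  have [measurable]: "(\<lambda>\<omega>. f (K \<omega>) \<omega>) \<in> borel_measurable M"
    by (rule measurable_compose_countable) measurable
  have part: "(\<Sum>k<m. indicator {k} (K \<omega>) * f k \<omega>) = (if K \<omega> < m then f (K \<omega>) \<omega> else 0)" for m \<omega>
  proof -
    have "(\<Sum>k<m. indicator {k} (K \<omega>) * f k \<omega>) = (\<Sum>k<m. if k = K \<omega> then f k \<omega> else 0)"
      by (intro sum.cong) (auto simp: indicator_def)
    then show ?thesis by simp
  qed
  have "(\<lambda>m. expectation (\<lambda>\<omega>. \<Sum>k<m. indicator {k} (K \<omega>) * f k \<omega>)) \<longlonglongrightarrow> expectation (\<lambda>\<omega>. f (K \<omega>) \<omega>)"
  proof (rule integral_dominated_convergence[where w = "\<lambda>_. 1"])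
    show "AE \<omega> in M. (\<lambda>m. \<Sum>k<m. indicator {k} (K \<omega>) * f k \<omega>) \<longlonglongrightarrow> f (K \<omega>) \<omega>"
    proof (intro AE_I2 tendsto_eventually)
      fix \<omega>
      show "\<forall>\<^sub>F m in sequentially. (\<Sum>k<m. indicator {k} (K \<omega>) * f k \<omega>) = f (K \<omega>) \<omega>"
        using eventually_gt_at_top[of "K \<omega>"] by eventually_elim (simp add: part)
    qed
    show "AE \<omega> in M. norm (\<Sum>k<m. indicator {k} (K \<omega>) * f k \<omega>) \<le> 1" for m
      unfolding part using bd by auto
  qed auto
  moreover have "expectation (\<lambda>\<omega>. \<Sum>k<m. indicator {k} (K \<omega>) * f k \<omega>)
      = (\<Sum>k<m. expectation (\<lambda>\<omega>. indicator {k} (K \<omega>) * f k \<omega>))" for m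
    using bd by (intro Bochner_Integration.integral_sum integrable_const_bound[where B=1])
      (auto simp: indicator_def)
  ultimately show ?thesis by (simp add: sums_def)
qed

lemma (in prob_space) prob_random_index:
  assumes [measurable]: "K \<in> measurable M (count_space UNIV)" "\<And>k. W k \<in> borel_measurable M"
    and ind: "\<And>k. indep_var borel (\<lambda>\<omega>. real (K \<omega>)) borel (W k)"
  shows "\<P>(\<omega> in M. W (K \<omega>) \<omega> \<le> c) = expectation (\<lambda>\<omega>. \<P>(\<omega>' in M. W (K \<omega>) \<omega>' \<le> c))"
proof -
  have [measurable]: "(\<lambda>\<omega>. W (K \<omega>) \<omega>) \<in> borel_measurable M"
    by (rule measurable_compose_countable) measurable
  have "(\<lambda>k. expectation (\<lambda>\<omega>. indicat_real {k} (K \<omega>) * indicat_real {..c} (W k \<omega>)))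
     sums expectation (\<lambda>\<omega>. indicat_real {..c} (W (K \<omega>) \<omega>))"
    by (rule sums_expectation_random_index) (auto simp: indicator_def)
  also have "(\<lambda>k. expectation (\<lambda>\<omega>. indicat_real {k} (K \<omega>) * indicat_real {..c} (W k \<omega>)))
      = (\<lambda>k. expectation (\<lambda>\<omega>. indicat_real {k} (K \<omega>) * \<P>(\<omega>' in M. W k \<omega>' \<le> c)))"
  proof
    fix k
    have "expectation (\<lambda>\<omega>. indicat_real {k} (K \<omega>) * indicat_real {..c} (W k \<omega>))
        = expectation (\<lambda>\<omega>. indicator ((\<lambda>\<omega>. (real (K \<omega>), W k \<omega>)) -` ({real k} \<times> {..c}) \<inter> space M) \<omega>)"
      by (intro Bochner_Integration.integral_cong) (auto simp: indicator_def)
    also have "\<dots> = prob ((\<lambda>\<omega>. (real (K \<omega>), W k \<omega>)) -` ({real k} \<times> {..c}) \<inter> space M)"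
      by simp
    also have "\<dots> = prob ((\<lambda>\<omega>. real (K \<omega>)) -` {real k} \<inter> space M) * prob (W k -` {..c} \<inter> space M)"
      by (rule indep_varD[OF ind]) auto
    also have "W k -` {..c} \<inter> space M = {\<omega>' \<in> space M. W k \<omega>' \<le> c}" by auto
    also have "prob ((\<lambda>\<omega>. real (K \<omega>)) -` {real k} \<inter> space M) = expectation (indicat_real (K -` {k} \<inter> space M))"
      by (simp add: vimage_def)
    also have "\<dots> = expectation (\<lambda>\<omega>. indicat_real {k} (K \<omega>))"
      by (intro Bochner_Integration.integral_cong) (auto simp: indicator_def)
    finally show "expectation (\<lambda>\<omega>. indicat_real {k} (K \<omega>) * indicat_real {..c} (W k \<omega>))
        = expectation (\<lambda>\<omega>. indicat_real {k} (K \<omega>) * \<P>(\<omega>' in M. W k \<omega>' \<le> c))"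
      by simp
  qed
  finally have "expectation (\<lambda>\<omega>. indicat_real {..c} (W (K \<omega>) \<omega>)) = expectation (\<lambda>\<omega>. \<P>(\<omega>' in M. W (K \<omega>) \<omega>' \<le> c))"
    by (rule sums_unique2) (rule sums_expectation_random_index, auto)
  moreover have "expectation (\<lambda>\<omega>. indicat_real {..c} (W (K \<omega>) \<omega>)) = expectation (indicat_real {\<omega> \<in> space M. W (K \<omega>) \<omega> \<le> c})"
    by (intro Bochner_Integration.integral_cong) (auto simp: indicator_def)
  ultimately show ?thesis by simp
qed

lemma tendsto_diff_zero_iff:
  fixes a b :: "nat \<Rightarrow> 'b::real_normed_vector"
  assumes "(\<lambda>n. a n - b n) \<longlonglongrightarrow> 0"
  shows "a \<longlonglongrightarrow> l \<longleftrightarrow> b \<longlonglongrightarrow> l"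
  using assms Lim_transform Lim_transform2 by blast

text \<open>
  The law of \<open>U * g Z\<close> with a standard normal \<open>Z\<close> independent of \<open>U\<close>.
\<close>

definition normal_mixture :: "'a measure \<Rightarrow> ('a \<Rightarrow> real) \<Rightarrow> (real \<Rightarrow> real) \<Rightarrow> real measure" where
  "normal_mixture M U g = distr (M \<Otimes>\<^sub>M std_normal_distribution) borel (\<lambda>(\<omega>, z). U \<omega> * g z)"

context prob_space
begin

lemma pair_prob_space_std_normal: "pair_prob_space M std_normal_distribution"
  by (simp add: pair_prob_space_def pair_sigma_finite_def prob_space_axioms
      prob_space_normal_density prob_space_imp_sigma_finite)

lemma normal_mixture_measurable:
  fixes U :: "'a \<Rightarrow> real" and g :: "real \<Rightarrow> real"
  assumes [measurable]: "U \<in> borel_measurable M" "g \<in> borel_measurable borel"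
  shows "(\<lambda>(\<omega>, z). U \<omega> * g z) \<in> borel_measurable (M \<Otimes>\<^sub>M std_normal_distribution)"
  by measurable

lemma real_distribution_normal_mixture:
  assumes "U \<in> borel_measurable M" "g \<in> borel_measurable borel"
  shows "real_distribution (normal_mixture M U g)"
proof -
  interpret P: pair_prob_space M std_normal_distribution by (rule pair_prob_space_std_normal)
  show ?thesis
    unfolding normal_mixture_def
    by (intro P.real_distribution_distr normal_mixture_measurable assms)
qed

lemma integral_normal_mixture:
  fixes f :: "real \<Rightarrow> 'b::{banach, second_countable_topology}"
  assumes [measurable]: "U \<in> borel_measurable M" "g \<in> borel_measurable borel"
    and [measurable]: "f \<in> borel_measurable borel" and bd: "\<And>x. norm (f x) \<le> 1"
  shows "integral\<^sup>L (normal_mixture M U g) f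
    = (\<integral>\<omega>. \<integral>z. f (U \<omega> * g z) \<partial>std_normal_distribution \<partial>M)"
proof -
  interpret P: pair_prob_space M std_normal_distribution by (rule pair_prob_space_std_normal)
  have rv: "(\<lambda>p. f (case p of (\<omega>, z) \<Rightarrow> U \<omega> * g z)) \<in> borel_measurable (M \<Otimes>\<^sub>M std_normal_distribution)"
    using normal_mixture_measurable[OF assms(1,2)] by measurable
  have "integral\<^sup>L (normal_mixture M U g) f
      = (\<integral>p. f (case p of (\<omega>, z) \<Rightarrow> U \<omega> * g z) \<partial>(M \<Otimes>\<^sub>M std_normal_distribution))"
    unfolding normal_mixture_def by (rule integral_distr[OF normal_mixture_measurable]) fact+
  also have "\<dots> = (\<integral>\<omega>. \<integral>z. f (U \<omega> * g z) \<partial>std_normal_distribution \<partial>M)"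
    by (subst P.integral_fst'[symmetric])
       (auto intro!: P.P.integrable_const_bound[where B=1] bd rv split: prod.splits)
  finally show ?thesis .
qed

lemma char_normal_mixture:
  assumes [measurable]: "U \<in> borel_measurable M"
  shows "char (normal_mixture M U (\<lambda>z. z)) t
    = complex_of_real (expectation (\<lambda>\<omega>. exp (- (t\<^sup>2 / 2) * (U \<omega>)\<^sup>2)))"
proof -
  have "char (normal_mixture M U (\<lambda>z. z)) t
      = (\<integral>\<omega>. \<integral>z. iexp (t * (U \<omega> * z)) \<partial>std_normal_distribution \<partial>M)"
    unfolding char_def by (rule integral_normal_mixture) auto
  also have "\<dots> = (\<integral>\<omega>. char std_normal_distribution (t * U \<omega>) \<partial>M)"
    by (simp add: char_def ac_simps)
  also have "\<dots> = (\<integral>\<omega>. complex_of_real (exp (- (t\<^sup>2 / 2) * (U \<omega>)\<^sup>2)) \<partial>M)"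
    by (simp add: char_std_normal_distribution power_mult_distrib)
  finally show ?thesis by simp
qed

text \<open>
  Conditionally on \<open>N n = k\<close>, the two distribution functions at \<open>x\<close> are those of \<open>W k / b k\<close> and of
  \<open>g Z\<close> at the point \<open>x * d n / b k\<close>. This point is out of control as \<open>n\<close> and \<open>k\<close> vary, which is why
  the convergence has to be uniform. Small values of \<open>k\<close>, among them \<open>k = 0\<close>, have vanishing probability.
\<close>

lemma random_index_cdf_diff:
  fixes W :: "nat \<Rightarrow> 'a \<Rightarrow> real" and N :: "nat \<Rightarrow> 'a \<Rightarrow> nat"
  assumes N_rv [measurable]: "\<And>n. N n \<in> measurable M (count_space UNIV)"
    and W_rv [measurable]: "\<And>k. W k \<in> borel_measurable M"
    and ind: "\<And>n k. indep_var borel (\<lambda>\<omega>. real (N n \<omega>)) borel (W k)"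
    and N_tends: "tends_to_infinity_in_prob M N"
    and b: "\<And>k. k \<ge> 1 \<Longrightarrow> 0 < b k" and d: "\<And>n. 0 < d n"
    and g [measurable]: "g \<in> borel_measurable borel"
    and conv: "weak_conv_m (\<lambda>k. distr M borel (\<lambda>\<omega>. W k \<omega> / b k)) (distr std_normal_distribution borel g)"
    and cont: "\<And>x. isCont (cdf (distr std_normal_distribution borel g)) x"
  shows "(\<lambda>n. cdf (distr M borel (\<lambda>\<omega>. W (N n \<omega>) \<omega> / d n)) x
            - cdf (normal_mixture M (\<lambda>\<omega>. b (N n \<omega>) / d n) g) x) \<longlonglongrightarrow> 0"
proof (rule tendstoI)
  fix \<delta> :: real assume \<delta>: "0 < \<delta>"
  interpret Z: real_distribution std_normal_distribution by (rule real_dist_normal_dist)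
  let ?\<mu> = "\<lambda>k. distr M borel (\<lambda>\<omega>. W k \<omega> / b k)" and ?\<zeta> = "distr std_normal_distribution borel g"
  define p where "p n k = \<P>(\<omega> in M. W k \<omega> / d n \<le> x)" for n k
  define q where "q n k = measure std_normal_distribution {z. b k / d n * g z \<le> x}" for n k
  have "\<forall>\<^sub>F k in sequentially. \<forall>x. \<bar>cdf (?\<mu> k) x - cdf ?\<zeta> x\<bar> < \<delta> / 2"
    using \<delta> by (intro weak_conv_m_uniform[OF _ _ conv cont] real_distribution_distr Z.real_distribution_distr) auto
  then obtain m where m: "\<And>k x. k \<ge> m \<Longrightarrow> \<bar>cdf (?\<mu> k) x - cdf ?\<zeta> x\<bar> < \<delta> / 2"
    by (auto simp: eventually_sequentially)
  have pq: "\<bar>p n k - q n k\<bar> \<le> \<delta> / 2" if "k > m" for n k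
  proof -
    have bk: "0 < b k" using that b by auto
    have "p n k = cdf (?\<mu> k) (x * d n / b k)"
      unfolding p_def cdf_def using bk d[of n]
      by (subst measure_distr) (auto intro!: arg_cong[where f="measure M"] simp: field_simps)
    moreover have "q n k = cdf ?\<zeta> (x * d n / b k)"
      unfolding q_def cdf_def using bk d[of n]
      by (subst measure_distr) (auto intro!: arg_cong[where f="measure std_normal_distribution"] simp: field_simps)
    ultimately show ?thesis using m[of k "x * d n / b k"] that by simp
  qed
  have pq1: "\<bar>p n k - q n k\<bar> \<le> 1" for n k
    using Z.prob_le_1[of "{z. b k / d n * g z \<le> x}"] prob_le_1[of "{\<omega> \<in> space M. W k \<omega> / d n \<le> x}"]
      measure_nonneg[of M "{\<omega> \<in> space M. W k \<omega> / d n \<le> x}"]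
      measure_nonneg[of std_normal_distribution "{z. b k / d n * g z \<le> x}"]
    unfolding p_def q_def by linarith
  have cdf_p: "cdf (distr M borel (\<lambda>\<omega>. W (N n \<omega>) \<omega> / d n)) x = expectation (\<lambda>\<omega>. p n (N n \<omega>))" for n
  proof -
    have [measurable]: "(\<lambda>\<omega>. W (N n \<omega>) \<omega>) \<in> borel_measurable M"
      by (rule measurable_compose_countable) measurable
    have "cdf (distr M borel (\<lambda>\<omega>. W (N n \<omega>) \<omega> / d n)) x = \<P>(\<omega> in M. W (N n \<omega>) \<omega> \<le> x * d n)"
      unfolding cdf_def using d[of n]
      by (subst measure_distr) (auto intro!: arg_cong[where f="measure M"] simp: field_simps)
    also have "\<dots> = expectation (\<lambda>\<omega>. \<P>(\<omega>' in M. W (N n \<omega>) \<omega>' \<le> x * d n))"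
      by (rule prob_random_index) (auto intro: ind)
    also have "\<dots> = expectation (\<lambda>\<omega>. p n (N n \<omega>))"
      unfolding p_def using d[of n] by (simp add: pos_divide_le_eq)
    finally show ?thesis .
  qed
  have cdf_q: "cdf (normal_mixture M (\<lambda>\<omega>. b (N n \<omega>) / d n) g) x = expectation (\<lambda>\<omega>. q n (N n \<omega>))" for n
  proof -
    interpret R: real_distribution "normal_mixture M (\<lambda>\<omega>. b (N n \<omega>) / d n) g"
      by (rule real_distribution_normal_mixture) auto
    have "cdf (normal_mixture M (\<lambda>\<omega>. b (N n \<omega>) / d n) g) x
        = integral\<^sup>L (normal_mixture M (\<lambda>\<omega>. b (N n \<omega>) / d n) g) (indicator {..x})"
      by (simp add: cdf_def)
    also have "\<dots> = (\<integral>\<omega>. \<integral>z. indicat_real {..x} (b (N n \<omega>) / d n * g z) \<partial>std_normal_distribution \<partial>M)"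
      by (rule integral_normal_mixture) auto
    also have "(\<lambda>\<omega>. \<integral>z. indicat_real {..x} (b (N n \<omega>) / d n * g z) \<partial>std_normal_distribution) = (\<lambda>\<omega>. q n (N n \<omega>))"
    proof
      fix \<omega>
      have "(\<integral>z. indicat_real {..x} (b (N n \<omega>) / d n * g z) \<partial>std_normal_distribution)
         = (\<integral>z. indicat_real {z. b (N n \<omega>) / d n * g z \<le> x} z \<partial>std_normal_distribution)"
        by (intro Bochner_Integration.integral_cong) (auto simp: indicator_def)
      then show "(\<integral>z. indicat_real {..x} (b (N n \<omega>) / d n * g z) \<partial>std_normal_distribution) = q n (N n \<omega>)"
        by (simp add: q_def)
    qed
    finally show ?thesis .
  qed
  have "(\<lambda>n. \<P>(\<omega> in M. real (N n \<omega>) \<le> real (Suc m))) \<longlonglongrightarrow> 0"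
    using N_tends by (auto simp: tends_to_infinity_in_prob_def)
  then have "\<forall>\<^sub>F n in sequentially. \<P>(\<omega> in M. real (N n \<omega>) \<le> real (Suc m)) < \<delta> / 2"
    using \<delta> by (intro order_tendstoD(2)) auto
  then show "\<forall>\<^sub>F n in sequentially. dist (cdf (distr M borel (\<lambda>\<omega>. W (N n \<omega>) \<omega> / d n)) x
            - cdf (normal_mixture M (\<lambda>\<omega>. b (N n \<omega>) / d n) g) x) 0 < \<delta>"
  proof eventually_elim
    case (elim n)
    have int: "integrable M (\<lambda>\<omega>. p n (N n \<omega>))" "integrable M (\<lambda>\<omega>. q n (N n \<omega>))"
      by (intro integrable_const_bound[where B=1], auto simp: p_def q_def)+
    have "cdf (distr M borel (\<lambda>\<omega>. W (N n \<omega>) \<omega> / d n)) x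
            - cdf (normal_mixture M (\<lambda>\<omega>. b (N n \<omega>) / d n) g) x
       = expectation (\<lambda>\<omega>. p n (N n \<omega>) - q n (N n \<omega>))"
      unfolding cdf_p cdf_q using int by simp
    also have "\<bar>\<dots>\<bar> \<le> expectation (\<lambda>\<omega>. \<bar>p n (N n \<omega>) - q n (N n \<omega>)\<bar>)"
      by (rule integral_abs_bound)
    also have "\<dots> \<le> expectation (\<lambda>\<omega>. \<delta> / 2 + indicator {\<omega> \<in> space M. real (N n \<omega>) \<le> real (Suc m)} \<omega>)"
    proof (intro integral_mono)
      fix \<omega> assume "\<omega> \<in> space M"
      then show "\<bar>p n (N n \<omega>) - q n (N n \<omega>)\<bar> \<le> \<delta> / 2 + indicator {\<omega> \<in> space M. real (N n \<omega>) \<le> real (Suc m)} \<omega>"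
        using pq[of "N n \<omega>" n] pq1[of n "N n \<omega>"] \<delta> by (cases "N n \<omega> \<le> Suc m") (auto simp: indicator_def)
    qed (use int in \<open>auto intro!: integrable_const_bound[where B="\<delta> / 2 + 1"] simp: indicator_def \<delta> less_imp_le\<close>)
    also have "\<dots> = \<delta> / 2 + \<P>(\<omega> in M. real (N n \<omega>) \<le> real (Suc m))"
      by (subst Bochner_Integration.integral_add)
        (auto intro!: integrable_const_bound[where B=1] simp: prob_space)
    also have "\<dots> < \<delta>" using elim by simp
    finally show ?case by (simp add: dist_real_def)
  qed
qed

corollary random_index_weak_conv_iff:
  fixes W :: "nat \<Rightarrow> 'a \<Rightarrow> real" and N :: "nat \<Rightarrow> 'a \<Rightarrow> nat"
  assumes "\<And>n. N n \<in> measurable M (count_space UNIV)"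
    and "\<And>k. W k \<in> borel_measurable M"
    and "\<And>n k. indep_var borel (\<lambda>\<omega>. real (N n \<omega>)) borel (W k)"
    and "tends_to_infinity_in_prob M N"
    and "\<And>k. k \<ge> 1 \<Longrightarrow> 0 < b k" and "\<And>n. 0 < d n"
    and "g \<in> borel_measurable borel"
    and "weak_conv_m (\<lambda>k. distr M borel (\<lambda>\<omega>. W k \<omega> / b k)) (distr std_normal_distribution borel g)"
    and "\<And>x. isCont (cdf (distr std_normal_distribution borel g)) x"
  shows "weak_conv_m (\<lambda>n. distr M borel (\<lambda>\<omega>. W (N n \<omega>) \<omega> / d n)) \<nu>
    \<longleftrightarrow> weak_conv_m (\<lambda>n. normal_mixture M (\<lambda>\<omega>. b (N n \<omega>) / d n) g) \<nu>"
  unfolding weak_conv_m_def weak_conv_def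
  using tendsto_diff_zero_iff[OF random_index_cdf_diff[OF assms]] by auto

end

section \<open>The limit laws of the extreme partial sums\<close>

lemma isCont_cdf_abs_std_normal: "isCont (cdf (distr std_normal_distribution borel abs)) x"
proof -
  interpret Z: real_distribution std_normal_distribution by (rule real_dist_normal_dist)
  interpret A: real_distribution "distr std_normal_distribution borel abs"
    by (rule Z.real_distribution_distr) simp
  have "measure (distr std_normal_distribution borel abs) {x} \<le> measure std_normal_distribution ({x} \<union> {- x})"
    by (subst measure_distr) (auto intro!: Z.finite_measure_mono)
  also have "\<dots> \<le> measure std_normal_distribution {x} + measure std_normal_distribution {- x}"
    by (rule measure_Un_le) auto
  finally have "measure (distr std_normal_distribution borel abs) {x} = 0"
    by (simp add: std_normal_singleton_null measure_le_0_iff)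
  then show ?thesis by (simp add: A.isCont_cdf)
qed

lemma isCont_cdf_neg_abs_std_normal:
  "isCont (cdf (distr std_normal_distribution borel (\<lambda>z. - \<bar>z\<bar>))) x"
proof -
  interpret Z: real_distribution std_normal_distribution by (rule real_dist_normal_dist)
  interpret A: real_distribution "distr std_normal_distribution borel abs"
    by (rule Z.real_distribution_distr) simp
  interpret A': real_distribution "distr std_normal_distribution borel (\<lambda>z. - \<bar>z\<bar>)"
    by (rule Z.real_distribution_distr) simp
  have "measure (distr std_normal_distribution borel (\<lambda>z. - \<bar>z\<bar>)) {x}
      = measure (distr std_normal_distribution borel abs) {- x}"
    by (subst (1 2) measure_distr) (auto intro!: arg_cong[where f="measure std_normal_distribution"])
  also have "\<dots> = 0"
    using isCont_cdf_abs_std_normal[of "- x"] by (simp add: A.isCont_cdf)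
  finally show ?thesis by (simp add: A'.isCont_cdf)
qed

lemma (in prob_space) cdf_distr_eq_prob:
  assumes [measurable]: "f \<in> borel_measurable M"
  shows "cdf (distr M borel f) x = \<P>(\<omega> in M. f \<omega> \<le> x)"
  unfolding cdf_def by (subst measure_distr) (auto intro!: arg_cong[where f="measure M"])

lemma (in prob_space) prob_gt_eq_cdf:
  assumes [measurable]: "f \<in> borel_measurable M"
  shows "\<P>(\<omega> in M. x < f \<omega>) = 1 - cdf (distr M borel f) x"
proof -
  have "\<P>(\<omega> in M. x < f \<omega>) = \<P>(\<omega> in M. \<not> f \<omega> \<le> x)" by (simp add: not_le)
  also have "\<dots> = 1 - \<P>(\<omega> in M. f \<omega> \<le> x)" by (rule prob_neg) measurable
  finally show ?thesis by (simp add: cdf_distr_eq_prob)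
qed

context lindeberg_sequence
begin

lemma prob_max_exceeds_tendsto:
  assumes x: "0 \<le> x"
  shows "(\<lambda>k. \<P>(\<omega> in M. x < max_partial_sum X k \<omega> / B k))
    \<longlonglongrightarrow> 2 * measure std_normal_distribution {x<..}"
proof (rule tendstoI)
  fix \<delta> :: real assume \<delta>: "0 < \<delta>"
  interpret Z: real_distribution std_normal_distribution by (rule real_dist_normal_dist)
  let ?\<Phi> = "cdf std_normal_distribution"
  let ?F = "\<lambda>k. cdf (distr M borel (\<lambda>\<omega>. partial_sum X k \<omega> / B k))"
  have F_lim: "(\<lambda>k. ?F k y) \<longlonglongrightarrow> ?\<Phi> y" for y
    using lindeberg_clt isCont_cdf_std_normal by (simp add: weak_conv_m_def weak_conv_def)
  have \<Phi>_lim: "((\<lambda>\<epsilon>. ?\<Phi> (f \<epsilon>)) \<longlongrightarrow> ?\<Phi> x) (at_right 0)" if "(f \<longlongrightarrow> x) (at_right 0)" for f :: "real \<Rightarrow> real"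
    by (rule isCont_tendsto_compose[OF isCont_cdf_std_normal that])
  have "((\<lambda>\<epsilon>. ?\<Phi> (x + \<epsilon>) - ?\<Phi> (x - 2 * \<epsilon>)) \<longlongrightarrow> ?\<Phi> x - ?\<Phi> x) (at_right 0)"
    by (intro tendsto_diff \<Phi>_lim) (auto intro!: tendsto_eq_intros)
  then have "\<forall>\<^sub>F \<epsilon> in at_right 0. ?\<Phi> (x + \<epsilon>) - ?\<Phi> (x - 2 * \<epsilon>) < \<delta> / 4"
    using \<delta> by (intro order_tendstoD(2)) auto
  then have "\<forall>\<^sub>F \<epsilon> in at_right 0. ?\<Phi> (x + \<epsilon>) - ?\<Phi> (x - 2 * \<epsilon>) < \<delta> / 4 \<and> 0 < \<epsilon>"
    by (intro eventually_conj eventually_at_right_less)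
  then obtain \<epsilon> where \<epsilon>: "?\<Phi> (x + \<epsilon>) - ?\<Phi> (x - 2 * \<epsilon>) < \<delta> / 4" "0 < \<epsilon>"
    using eventually_happens'[OF trivial_limit_at_right_real] by blast
  define \<rho> where "\<rho> = \<epsilon> * \<delta> / 8"
  have \<rho>: "0 < \<rho>" "\<rho> / \<epsilon> = \<delta> / 8" using \<epsilon> \<delta> by (auto simp: \<rho>_def)
  define h where "h = (\<lambda>y. max (-1) (min 1 (y / \<epsilon>)))"
  have "\<forall>\<^sub>F k in sequentially. \<forall>j\<le>k. \<bar>expectation (\<lambda>\<omega>. h ((\<Sum>i\<in>{j<..k}. X i \<omega>) / B k))\<bar> < \<delta> / 8"
  proof (rule increment_odd_uniform)
    show "isCont h y" for y
      unfolding h_def using \<epsilon> by (intro continuous_intros) auto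
    show "\<bar>h y\<bar> \<le> 1" for y by (auto simp: h_def)
    show "h (- y) = - h y" for y by (auto simp: h_def max_def min_def)
  qed (use \<delta> in auto)
  moreover have "\<forall>\<^sub>F k in sequentially. 2 / \<rho>\<^sup>2 * lindeberg_ratio k \<rho> < \<delta> / 8"
    using tendsto_mult_right_zero[OF lindeberg_ratio_tendsto[OF \<rho>(1)], of "2 / \<rho>\<^sup>2"] \<delta>
    by (intro order_tendstoD(2)) auto
  moreover have "\<forall>\<^sub>F k in sequentially. ?F k (x + \<epsilon>) - ?F k (x - 2 * \<epsilon>) < \<delta> / 4"
    using tendsto_diff[OF F_lim F_lim] \<epsilon> by (intro order_tendstoD(2)) auto
  moreover have "\<forall>\<^sub>F k in sequentially. \<bar>?F k x - ?\<Phi> x\<bar> < \<delta> / 8"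
    using tendstoD[OF F_lim[of x], of "\<delta> / 8"] \<delta> by (simp add: dist_real_def)
  ultimately show "\<forall>\<^sub>F k in sequentially. dist (\<P>(\<omega> in M. x < max_partial_sum X k \<omega> / B k))
      (2 * measure std_normal_distribution {x<..}) < \<delta>"
    using eventually_ge_at_top[of 1]
  proof eventually_elim
    case (elim k)
    \<comment> \<open>The half-open interval from \<open>x - 2 * \<epsilon>\<close> is used because distribution functions only see
      half-open intervals.\<close>
    have near: "\<P>(\<omega> in M. \<bar>partial_sum X k \<omega> / B k - x\<bar> \<le> \<epsilon>) \<le> ?F k (x + \<epsilon>) - ?F k (x - 2 * \<epsilon>)"
    proof -
      have "\<P>(\<omega> in M. \<bar>partial_sum X k \<omega> / B k - x\<bar> \<le> \<epsilon>)
          \<le> prob ({\<omega> \<in> space M. partial_sum X k \<omega> / B k \<le> x + \<epsilon>} - {\<omega> \<in> space M. partial_sum X k \<omega> / B k \<le> x - 2 * \<epsilon>})"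
        using \<epsilon> by (intro finite_measure_mono) auto
      also have "\<dots> = ?F k (x + \<epsilon>) - ?F k (x - 2 * \<epsilon>)"
        using \<epsilon> by (subst finite_measure_Diff) (auto simp: cdf_distr_eq_prob)
      finally show ?thesis .
    qed
    have "\<bar>2 * \<P>(\<omega> in M. x < partial_sum X k \<omega> / B k) - \<P>(\<omega> in M. x < max_partial_sum X k \<omega> / B k)\<bar>
      \<le> \<delta> / 8 + \<rho> / \<epsilon> + 2 / \<rho>\<^sup>2 * lindeberg_ratio k \<rho> + \<P>(\<omega> in M. \<bar>partial_sum X k \<omega> / B k - x\<bar> \<le> \<epsilon>)"
      using elim(1) by (intro reflection_estimate elim(5) x \<epsilon> \<rho>) (auto simp: h_def less_imp_le)
    moreover have "\<P>(\<omega> in M. x < partial_sum X k \<omega> / B k) = 1 - ?F k x"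
      by (rule prob_gt_eq_cdf) measurable
    moreover have "measure std_normal_distribution {x<..} = 1 - ?\<Phi> x"
    proof -
      have "measure std_normal_distribution {x<..} = measure std_normal_distribution (UNIV - {..x})"
        by (intro arg_cong[where f="measure std_normal_distribution"]) auto
      then show ?thesis
        using Z.prob_compl[of "{..x}"] by (simp add: cdf_def)
    qed
    ultimately show ?case
      using elim(2-4) near \<rho>(2) unfolding dist_real_def by linarith
  qed
qed

text \<open>
  The reflection estimate covers \<open>x \<ge> 0\<close>. For negative \<open>x\<close>, where the maximum may still be
  negative as it is taken over nonempty sums only, monotonicity reduces the claim to \<open>x = 0\<close>.
\<close>

theorem max_partial_sum_weak_conv:
  "weak_conv_m (\<lambda>k. distr M borel (\<lambda>\<omega>. max_partial_sum X k \<omega> / B k)) (distr std_normal_distribution borel abs)"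
  unfolding weak_conv_m_def weak_conv_def
proof (intro allI impI)
  fix x :: real
  interpret Z: real_distribution std_normal_distribution by (rule real_dist_normal_dist)
  let ?F = "\<lambda>k. cdf (distr M borel (\<lambda>\<omega>. max_partial_sum X k \<omega> / B k))"
  have F: "?F k x = 1 - \<P>(\<omega> in M. x < max_partial_sum X k \<omega> / B k)" for k x
    by (subst prob_gt_eq_cdf) auto
  have nonneg: "(\<lambda>k. ?F k x) \<longlonglongrightarrow> cdf (distr std_normal_distribution borel abs) x" if "0 \<le> x" for x
    using tendsto_diff[OF tendsto_const[of 1] prob_max_exceeds_tendsto[OF that]] that
    unfolding F by (simp add: cdf_abs_normal)
  show "(\<lambda>k. ?F k x) \<longlonglongrightarrow> cdf (distr std_normal_distribution borel abs) x"
  proof (cases "0 \<le> x")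
    case False
    have "measure std_normal_distribution {z. \<bar>z\<bar> \<le> 0} = 0"
      using std_normal_singleton_null[of 0] by simp
    then have "cdf (distr std_normal_distribution borel abs) 0 = 0"
      unfolding cdf_def by (subst measure_distr) (auto simp: vimage_def)
    then have "(\<lambda>k. ?F k 0) \<longlonglongrightarrow> 0" using nonneg[of 0] by simp
    then have "(\<lambda>k. ?F k x) \<longlonglongrightarrow> 0"
    proof (rule tendsto_sandwich[rotated 3])
      show "\<forall>\<^sub>F k in sequentially. ?F k x \<le> ?F k 0"
        using False by (intro always_eventually allI finite_borel_measure.cdf_nondecreasing
            real_distribution.finite_borel_measure_M real_distribution_distr) auto
    qed (auto simp: cdf_def)
    then show ?thesis using False by (simp add: cdf_abs_normal)
  qed (rule nonneg)
qed

lemma abs_partial_sum_weak_conv: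
  "weak_conv_m (\<lambda>k. distr M borel (\<lambda>\<omega>. \<bar>partial_sum X k \<omega>\<bar> / B k)) (distr std_normal_distribution borel abs)"
proof -
  have "weak_conv_m (\<lambda>k. distr (distr M borel (\<lambda>\<omega>. partial_sum X k \<omega> / B k)) borel abs)
      (distr std_normal_distribution borel abs)"
    by (rule weak_conv_m_continuous_map[OF _ _ lindeberg_clt])
      (auto intro: real_dist_normal_dist continuous_intros)
  moreover have "distr (distr M borel (\<lambda>\<omega>. partial_sum X k \<omega> / B k)) borel abs
      = distr M borel (\<lambda>\<omega>. \<bar>partial_sum X k \<omega>\<bar> / B k)" for k
  proof -
    have "0 \<le> B k" using B2_mono[of 0 k] by simp
    then show ?thesis by (subst distr_distr) (auto simp: comp_def)
  qed
  ultimately show ?thesis by simp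
qed

lemma lindeberg_sequence_uminus: "lindeberg_sequence M (\<lambda>i \<omega>. - X i \<omega>)"
proof
  show "indep_vars (\<lambda>_. borel) (\<lambda>i \<omega>. - X i \<omega>) {1..}"
    by (rule indep_vars_compose2[OF indep]) auto
  show v: "0 < variance (\<lambda>\<omega>. - X i \<omega>)" if "i \<ge> 1" for i
    using variance_pos[OF that] mean_zero[OF that] by simp
  have var: "sum_variance M (\<lambda>i \<omega>. - X i \<omega>) k = B2 k" for k
    unfolding sum_variance_def by (intro sum.cong) (auto simp: mean_zero)
  have int: "(LINT x:{x. \<bar>x\<bar> \<ge> c}|distr M borel (\<lambda>\<omega>. - X i \<omega>). x\<^sup>2)
      = (LINT x:{x. \<bar>x\<bar> \<ge> c}|distr M borel (X i). x\<^sup>2)" if "i \<ge> 1" for c i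
    using that by (simp add: set_lebesgue_integral_def integral_distr indicator_def)
  show "lindeberg M (\<lambda>i \<omega>. - X i \<omega>)"
    using lindeberg by (simp add: lindeberg_def var int)
qed (auto simp: square_integrable mean_zero)

lemma min_partial_sum_eq: "min_partial_sum X k \<omega> = - max_partial_sum (\<lambda>i \<omega>. - X i \<omega>) k \<omega>"
proof (cases "k = 0")
  case False
  then have "- Max ((\<lambda>i. - partial_sum X i \<omega>) ` {1..k}) = Min (uminus ` (\<lambda>i. - partial_sum X i \<omega>) ` {1..k})"
    by (intro minus_Max_eq_Min) auto
  then show ?thesis
    using False by (simp add: min_partial_sum_def max_partial_sum_def partial_sum_def sum_negf image_image)
qed (simp add: min_partial_sum_def max_partial_sum_def)

lemma min_partial_sum_weak_conv:
  "weak_conv_m (\<lambda>k. distr M borel (\<lambda>\<omega>. min_partial_sum X k \<omega> / B k))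
     (distr std_normal_distribution borel (\<lambda>z. - \<bar>z\<bar>))"
proof -
  interpret neg: lindeberg_sequence M "\<lambda>i \<omega>. - X i \<omega>" by (rule lindeberg_sequence_uminus)
  have B2: "sum_variance M (\<lambda>i \<omega>. - X i \<omega>) k = B2 k" for k
    unfolding sum_variance_def by (intro sum.cong) (auto simp: mean_zero)
  interpret Z: real_distribution std_normal_distribution by (rule real_dist_normal_dist)
  have "weak_conv_m (\<lambda>k. distr (distr M borel (\<lambda>\<omega>. max_partial_sum (\<lambda>i \<omega>. - X i \<omega>) k \<omega> / B k)) borel uminus)
      (distr (distr std_normal_distribution borel abs) borel uminus)"
    using neg.max_partial_sum_weak_conv unfolding B2
    by (intro weak_conv_m_continuous_map) (auto intro!: continuous_intros)
  then show ?thesis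
    by (simp add: distr_distr comp_def min_partial_sum_eq)
qed

end

section \<open>Moduli, signs and Laplace transforms in weak convergence\<close>

lemma weak_conv_m_uminus_iff:
  assumes \<mu>: "\<And>n. real_distribution (\<mu> n)" and \<nu>: "real_distribution \<nu>"
  shows "weak_conv_m (\<lambda>n. distr (\<mu> n) borel uminus) (distr \<nu> borel uminus) \<longleftrightarrow> weak_conv_m \<mu> \<nu>"
proof -
  interpret \<mu>: real_distribution "\<mu> n" for n by fact
  interpret \<nu>: real_distribution \<nu> by fact
  have id: "distr (distr \<kappa> borel uminus) borel uminus = \<kappa>" if "real_distribution \<kappa>" for \<kappa> :: "real measure"
  proof -
    interpret \<kappa>: real_distribution \<kappa> by fact
    show ?thesis by (simp add: distr_distr comp_def distr_id2)
  qed
  have "weak_conv_m \<mu> \<nu>"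
    if "weak_conv_m (\<lambda>n. distr (\<mu> n) borel uminus) (distr \<nu> borel uminus)"
    using weak_conv_m_continuous_map[OF _ _ that, of uminus] by (auto simp: id \<mu> \<nu> intro: continuous_intros)
  moreover have "weak_conv_m (\<lambda>n. distr (\<mu> n) borel uminus) (distr \<nu> borel uminus)" if "weak_conv_m \<mu> \<nu>"
    by (rule weak_conv_m_continuous_map[OF \<mu> \<nu> that]) (intro continuous_intros)
  ultimately show ?thesis by blast
qed

lemma (in real_distribution) Re_char: "Re (char M t) = (\<integral>x. cos (t * x) \<partial>M)"
proof -
  have "Re (char M t) = (\<integral>x. Re (iexp (t * x)) \<partial>M)"
    unfolding char_def by (rule integral_Re[symmetric]) (auto intro!: integrable_const_bound[where B=1])
  then show ?thesis by (simp add: Re_exp)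
qed

text \<open>
  A real characteristic function is the mean of \<open>cos (t * x)\<close>, which depends on \<open>\<bar>x\<bar>\<close> only.
\<close>

lemma weak_conv_m_abs_iff:
  assumes \<mu>: "\<And>n. real_distribution (\<mu> n)" and \<nu>: "real_distribution \<nu>"
    and real: "\<And>n t. char (\<mu> n) t \<in> \<real>" "\<And>t. char \<nu> t \<in> \<real>"
  shows "weak_conv_m (\<lambda>n. distr (\<mu> n) borel abs) (distr \<nu> borel abs) \<longleftrightarrow> weak_conv_m \<mu> \<nu>"
proof
  interpret \<mu>: real_distribution "\<mu> n" for n by fact
  interpret \<nu>: real_distribution \<nu> by fact
  assume conv: "weak_conv_m (\<lambda>n. distr (\<mu> n) borel abs) (distr \<nu> borel abs)"
  have char: "char \<kappa> t = of_real (\<integral>x. cos (t * x) \<partial>distr \<kappa> borel abs)"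
    if "real_distribution \<kappa>" and re: "char \<kappa> t \<in> \<real>" for \<kappa> t
  proof -
    interpret \<kappa>: real_distribution \<kappa> by fact
    have "cos (t * \<bar>x\<bar>) = cos (t * x)" for x by (simp add: abs_if)
    then have "(\<integral>x. cos (t * x) \<partial>distr \<kappa> borel abs) = Re (char \<kappa> t)"
      by (simp add: integral_distr \<kappa>.Re_char)
    then show ?thesis using re by simp
  qed
  show "weak_conv_m \<mu> \<nu>"
  proof (rule levy_continuity[OF \<mu> \<nu>])
    fix t
    have "(\<lambda>n. \<integral>x. cos (t * x) \<partial>distr (\<mu> n) borel abs) \<longlonglongrightarrow> (\<integral>x. cos (t * x) \<partial>distr \<nu> borel abs)"
      by (rule weak_conv_imp_integral_bdd_continuous_conv[where B=1, OF _ _ conv])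
        (auto intro!: continuous_intros)
    then show "(\<lambda>n. char (\<mu> n) t) \<longlonglongrightarrow> char \<nu> t"
      unfolding char[OF \<mu> real(1)] char[OF \<nu> real(2)] by (rule tendsto_of_real)
  qed
next
  assume "weak_conv_m \<mu> \<nu>"
  then show "weak_conv_m (\<lambda>n. distr (\<mu> n) borel abs) (distr \<nu> borel abs)"
    by (rule weak_conv_m_continuous_map[OF \<mu> \<nu>]) (intro continuous_intros)
qed

lemma (in prob_space) distr_normal_mixture:
  assumes [measurable]: "U \<in> borel_measurable M" "g \<in> borel_measurable borel" "f \<in> borel_measurable borel"
    and eq: "\<And>\<omega> z. \<omega> \<in> space M \<Longrightarrow> f (U \<omega> * g z) = U \<omega> * g' z"
  shows "distr (normal_mixture M U g) borel f = normal_mixture M U g'"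
  unfolding normal_mixture_def
  by (subst distr_distr[OF _ normal_mixture_measurable])
     (auto intro!: distr_cong simp: eq space_pair_measure)

text \<open>
  The continuity theorem for Laplace transforms. The transform of \<open>Y n\<close> at the integers consists of
  the moments of \<open>exp (- Y n)\<close>, which lies in the unit interval. By the Weierstrass approximation
  theorem their convergence implies that of the means of all continuous functions of \<open>exp (- Y n)\<close>.
\<close>

lemma laplace_weak_conv_iff:
  fixes Y :: "nat \<Rightarrow> 'a \<Rightarrow> real" and V :: "'b \<Rightarrow> real"
  assumes M: "prob_space M" and Q: "prob_space Q"
    and Y_rv [measurable]: "\<And>n. Y n \<in> borel_measurable M" and V_rv [measurable]: "V \<in> borel_measurable Q"
    and Y: "\<And>n \<omega>. \<omega> \<in> space M \<Longrightarrow> 0 \<le> Y n \<omega>" and V: "\<And>\<omega>. \<omega> \<in> space Q \<Longrightarrow> 0 \<le> V \<omega>"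
  shows "weak_conv_m (\<lambda>n. distr M borel (Y n)) (distr Q borel V) \<longleftrightarrow>
    (\<forall>s\<ge>0. (\<lambda>n. \<integral>\<omega>. exp (- s * Y n \<omega>) \<partial>M) \<longlonglongrightarrow> (\<integral>\<omega>. exp (- s * V \<omega>) \<partial>Q))"
proof (intro iffI allI impI)
  interpret M: prob_space M by fact
  interpret Q: prob_space Q by fact
  fix s :: real assume conv: "weak_conv_m (\<lambda>n. distr M borel (Y n)) (distr Q borel V)" and s: "0 \<le> s"
  let ?f = "\<lambda>y. exp (- s * max 0 y) :: real"
  have "(\<lambda>n. integral\<^sup>L (distr M borel (Y n)) ?f) \<longlonglongrightarrow> integral\<^sup>L (distr Q borel V) ?f"
    using s by (intro weak_conv_imp_integral_bdd_continuous_conv[where B=1, OF _ _ conv] continuous_intros) auto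
  moreover have "integral\<^sup>L (distr M borel (Y n)) ?f = (\<integral>\<omega>. exp (- s * Y n \<omega>) \<partial>M)" for n
    by (subst integral_distr) (auto intro!: Bochner_Integration.integral_cong simp: Y max_def)
  moreover have "integral\<^sup>L (distr Q borel V) ?f = (\<integral>\<omega>. exp (- s * V \<omega>) \<partial>Q)"
    by (subst integral_distr) (auto intro!: Bochner_Integration.integral_cong simp: V max_def)
  ultimately show "(\<lambda>n. \<integral>\<omega>. exp (- s * Y n \<omega>) \<partial>M) \<longlonglongrightarrow> (\<integral>\<omega>. exp (- s * V \<omega>) \<partial>Q)"
    by simp
next
  interpret M: prob_space M by fact
  interpret Q: prob_space Q by fact
  assume lap: "\<forall>s\<ge>0. (\<lambda>n. \<integral>\<omega>. exp (- s * Y n \<omega>) \<partial>M) \<longlonglongrightarrow> (\<integral>\<omega>. exp (- s * V \<omega>) \<partial>Q)"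
  have unit_interval: "(\<lambda>n. \<integral>\<omega>. f (exp (- Y n \<omega>)) \<partial>M) \<longlonglongrightarrow> (\<integral>\<omega>. f (exp (- V \<omega>)) \<partial>Q)"
    if f: "continuous_on UNIV f" for f :: "real \<Rightarrow> real"
  proof (rule tendstoI)
    fix \<epsilon> :: real assume \<epsilon>: "0 < \<epsilon>"
    have [measurable]: "f \<in> borel_measurable borel" using f by (rule borel_measurable_continuous_onI)
    obtain p where "real_polynomial_function p" and p_approx: "\<And>w. w \<in> {0..1} \<Longrightarrow> \<bar>f w - p w\<bar> < \<epsilon> / 4"
    proof (rule Stone_Weierstrass_real_polynomial_function)
      show "continuous_on {0..1} f" using f continuous_on_subset by blast
      show "0 < \<epsilon> / 4" using \<epsilon> by simp
    qed auto
    then obtain a m where p: "p = (\<lambda>w. \<Sum>i\<le>m. a i * w ^ i)"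
      by (auto simp: real_polynomial_function_iff_sum)
    have p_int: "integrable N (\<lambda>\<omega>. p (exp (- Z \<omega>)))" "integrable N (\<lambda>\<omega>. f (exp (- Z \<omega>)))"
      "(\<integral>\<omega>. p (exp (- Z \<omega>)) \<partial>N) = (\<Sum>i\<le>m. a i * (\<integral>\<omega>. exp (- real i * Z \<omega>) \<partial>N))"
      "\<bar>(\<integral>\<omega>. f (exp (- Z \<omega>)) \<partial>N) - (\<integral>\<omega>. p (exp (- Z \<omega>)) \<partial>N)\<bar> \<le> \<epsilon> / 4"
      if "prob_space N" and [measurable]: "Z \<in> borel_measurable N" and Z: "\<And>\<omega>. \<omega> \<in> space N \<Longrightarrow> 0 \<le> Z \<omega>"
      for N :: "'c measure" and Z
    proof -
      interpret N: prob_space N by fact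
      have pow: "exp (- Z \<omega>) ^ i = exp (- real i * Z \<omega>)" for \<omega> i
        by (simp add: exp_of_nat_mult[symmetric])
      have int: "integrable N (\<lambda>\<omega>. exp (- real i * Z \<omega>))" for i
        by (rule N.integrable_const_bound[where B=1]) (auto simp: Z)
      show int_p: "integrable N (\<lambda>\<omega>. p (exp (- Z \<omega>)))"
        unfolding p pow by (intro Bochner_Integration.integrable_sum integrable_mult_right int)
      show "(\<integral>\<omega>. p (exp (- Z \<omega>)) \<partial>N) = (\<Sum>i\<le>m. a i * (\<integral>\<omega>. exp (- real i * Z \<omega>) \<partial>N))"
        unfolding p pow using int by (subst Bochner_Integration.integral_sum) auto
      have close: "\<bar>f (exp (- Z \<omega>)) - p (exp (- Z \<omega>))\<bar> \<le> \<epsilon> / 4" if "\<omega> \<in> space N" for \<omega>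
        using p_approx[of "exp (- Z \<omega>)"] Z[OF that] by (simp add: less_imp_le)
      have int_d: "integrable N (\<lambda>\<omega>. f (exp (- Z \<omega>)) - p (exp (- Z \<omega>)))"
        using close borel_measurable_integrable[OF int_p]
        by (intro N.integrable_const_bound[where B="\<epsilon> / 4"] AE_I2 borel_measurable_diff) (simp, measurable)
      from Bochner_Integration.integrable_add[OF int_d int_p]
      show int_f: "integrable N (\<lambda>\<omega>. f (exp (- Z \<omega>)))" by simp
      have "\<bar>\<integral>\<omega>. f (exp (- Z \<omega>)) - p (exp (- Z \<omega>)) \<partial>N\<bar> \<le> (\<integral>\<omega>. \<bar>f (exp (- Z \<omega>)) - p (exp (- Z \<omega>))\<bar> \<partial>N)"
        by (rule integral_abs_bound)
      also have "\<dots> \<le> (\<integral>\<omega>. \<epsilon> / 4 \<partial>N)"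
        using int_d by (intro integral_mono close integrable_abs) auto
      finally show "\<bar>(\<integral>\<omega>. f (exp (- Z \<omega>)) \<partial>N) - (\<integral>\<omega>. p (exp (- Z \<omega>)) \<partial>N)\<bar> \<le> \<epsilon> / 4"
        using int_f int_p by (simp add: N.prob_space)
    qed
    have "(\<lambda>n. \<integral>\<omega>. p (exp (- Y n \<omega>)) \<partial>M) \<longlonglongrightarrow> (\<integral>\<omega>. p (exp (- V \<omega>)) \<partial>Q)"
    proof -
      have "(\<lambda>n. \<Sum>i\<le>m. a i * (\<integral>\<omega>. exp (- real i * Y n \<omega>) \<partial>M))
          \<longlonglongrightarrow> (\<Sum>i\<le>m. a i * (\<integral>\<omega>. exp (- real i * V \<omega>) \<partial>Q))"
        by (intro tendsto_sum tendsto_mult_left lap[rule_format]) auto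
      moreover have "(\<integral>\<omega>. p (exp (- Y n \<omega>)) \<partial>M) = (\<Sum>i\<le>m. a i * (\<integral>\<omega>. exp (- real i * Y n \<omega>) \<partial>M))" for n
        by (rule p_int(3)[OF M Y_rv Y])
      moreover have "(\<integral>\<omega>. p (exp (- V \<omega>)) \<partial>Q) = (\<Sum>i\<le>m. a i * (\<integral>\<omega>. exp (- real i * V \<omega>) \<partial>Q))"
        by (rule p_int(3)[OF Q V_rv V])
      ultimately show ?thesis by (simp only:)
    qed
    then have "\<forall>\<^sub>F n in sequentially. \<bar>(\<integral>\<omega>. p (exp (- Y n \<omega>)) \<partial>M) - (\<integral>\<omega>. p (exp (- V \<omega>)) \<partial>Q)\<bar> < \<epsilon> / 4"
      using \<epsilon> by (auto simp: tendsto_iff dist_real_def dest!: spec[of _ "\<epsilon> / 4"])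
    then show "\<forall>\<^sub>F n in sequentially. dist (\<integral>\<omega>. f (exp (- Y n \<omega>)) \<partial>M) (\<integral>\<omega>. f (exp (- V \<omega>)) \<partial>Q) < \<epsilon>"
    proof eventually_elim
      case (elim n)
      then show ?case
        using p_int(4)[OF M Y_rv Y, of n] p_int(4)[OF Q V_rv V] \<epsilon> unfolding dist_real_def by linarith
    qed
  qed
  show "weak_conv_m (\<lambda>n. distr M borel (Y n)) (distr Q borel V)"
  proof (rule integral_cts_step_conv_imp_weak_conv)
    fix a b :: real assume ab: "a < b"
    have cont: "continuous_on UNIV (cts_step a b)"
      using cts_step_uniformly_continuous[OF ab] by (rule uniformly_continuous_imp_continuous)
    \<comment> \<open>\<open>?f\<close> is the step function in the variable \<open>w = exp (- y)\<close>. Cutting \<open>w\<close> off at \<open>exp (- b)\<close> does not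
      change it, since the step function vanishes from \<open>b\<close> on, and makes it continuous at \<open>w = 0\<close>.\<close>
    let ?f = "\<lambda>w. cts_step a b (- ln (max w (exp (- b))))"
    have f_eq: "?f (exp (- y)) = cts_step a b y" for y
      using ab by (cases "y \<le> b") (auto simp: max_def cts_step_def)
    have "max w (exp (- b)) \<noteq> 0" for w
      using exp_gt_zero[of "- b"] by linarith
    then have "continuous_on UNIV ?f"
      by (intro continuous_on_compose2[OF cont] continuous_intros) auto
    from unit_interval[OF this]
    have "(\<lambda>n. \<integral>\<omega>. cts_step a b (Y n \<omega>) \<partial>M) \<longlonglongrightarrow> (\<integral>\<omega>. cts_step a b (V \<omega>) \<partial>Q)"
      unfolding f_eq .
    moreover have [measurable]: "cts_step a b \<in> borel_measurable borel"
      using cont by (rule borel_measurable_continuous_onI)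
    ultimately show "(\<lambda>n. integral\<^sup>L (distr M borel (Y n)) (cts_step a b)) \<longlonglongrightarrow> integral\<^sup>L (distr Q borel V) (cts_step a b)"
      by (simp add: integral_distr)
  qed auto
qed

section \<open>Random sums and the Linnik law\<close>

lemma partial_sum_path_measurable:
  "j \<le> k \<Longrightarrow> partial_sum (\<lambda>i f. f i) j \<in> borel_measurable (PiM {1..k} (\<lambda>_. borel))"
  unfolding partial_sum_def by (intro borel_measurable_sum measurable_component_singleton) auto

lemma max_partial_sum_path_measurable:
  "max_partial_sum (\<lambda>i f. f i) k \<in> borel_measurable (PiM {1..k} (\<lambda>_. borel))"
  unfolding max_partial_sum_def
  by (cases "k = 0") (auto intro!: borel_measurable_Max partial_sum_path_measurable simp del: One_nat_def)

lemma min_partial_sum_path_measurable: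
  "min_partial_sum (\<lambda>i f. f i) k \<in> borel_measurable (PiM {1..k} (\<lambda>_. borel))"
  unfolding min_partial_sum_def
  by (cases "k = 0") (auto intro!: borel_measurable_Min partial_sum_path_measurable simp del: One_nat_def)

lemma partial_sum_path:
  "j \<le> k \<Longrightarrow> partial_sum (\<lambda>i f. f i) j (restrict (\<lambda>i. X i \<omega>) {1..k}) = partial_sum X j \<omega>"
  unfolding partial_sum_def by (intro sum.cong) auto

lemma max_partial_sum_path:
  "max_partial_sum (\<lambda>i f. f i) k (restrict (\<lambda>i. X i \<omega>) {1..k}) = max_partial_sum X k \<omega>"
  unfolding max_partial_sum_def by (auto simp: partial_sum_path simp del: One_nat_def intro!: arg_cong[where f=Max] image_cong)

lemma min_partial_sum_path:
  "min_partial_sum (\<lambda>i f. f i) k (restrict (\<lambda>i. X i \<omega>) {1..k}) = min_partial_sum X k \<omega>"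
  unfolding min_partial_sum_def by (auto simp: partial_sum_path simp del: One_nat_def intro!: arg_cong[where f=Min] image_cong)

text \<open>
  The extreme partial sums are functionals of the path \<open>X 1, \<dots>, X k\<close>; in this form their
  independence of the index follows from the joint independence.
\<close>

lemma (in prob_space) indep_var_index_path:
  fixes X :: "nat \<Rightarrow> 'a \<Rightarrow> real" and K :: "'a \<Rightarrow> nat"
  assumes ind: "indep_vars (\<lambda>_. borel) (\<lambda>i. if i = 0 then (\<lambda>\<omega>. real (K \<omega>)) else X i) {0..}"
    and G: "G \<in> borel_measurable (PiM {1..k} (\<lambda>_. borel))"
  shows "indep_var borel (\<lambda>\<omega>. real (K \<omega>)) borel (\<lambda>\<omega>. G (restrict (\<lambda>i. X i \<omega>) {1..k}))"
proof -
  let ?X = "\<lambda>i. if i = 0 then (\<lambda>\<omega>. real (K \<omega>)) else X i"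
  have "indep_var (PiM {0} (\<lambda>_. borel)) (\<lambda>\<omega>. restrict (\<lambda>i. ?X i \<omega>) {0})
      (PiM {1..k} (\<lambda>_. borel)) (\<lambda>\<omega>. restrict (\<lambda>i. ?X i \<omega>) {1..k})"
    by (rule indep_var_restrict[OF ind]) auto
  then have "indep_var borel ((\<lambda>f. f 0) \<circ> (\<lambda>\<omega>. restrict (\<lambda>i. ?X i \<omega>) {0}))
      borel (G \<circ> (\<lambda>\<omega>. restrict (\<lambda>i. ?X i \<omega>) {1..k}))"
    by (rule indep_var_compose) (use G in \<open>auto intro: measurable_component_singleton simp del: One_nat_def\<close>)
  moreover have "restrict (\<lambda>i. ?X i \<omega>) {1..k} = restrict (\<lambda>i. X i \<omega>) {1..k}" for \<omega>
    by (rule restrict_ext) auto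
  ultimately show ?thesis by (simp add: comp_def)
qed

lemma converges_in_distribution_Suc:
  "converges_in_distribution M (\<lambda>n. Y (Suc n)) P Z \<longleftrightarrow> converges_in_distribution M Y P Z"
  unfolding converges_in_distribution_def weak_conv_m_def weak_conv_def
  using filterlim_sequentially_Suc[of "\<lambda>n. cdf (distr M borel (Y n)) x" for x] by simp

lemma linnik_distribution:
  assumes "linnik_rv \<alpha> P L"
  shows "real_distribution (distr P borel L)" and "char (distr P borel L) t = of_real (1 / (1 + \<bar>t\<bar> powr \<alpha>))"
  using assms by (auto simp: linnik_rv_def intro: prob_space.real_distribution_distr)

text \<open>
  The characteristic function of the mixture at \<open>t\<close> is the Laplace transform of the squared scale at
  \<open>t\<^sup>2 / 2\<close>, and \<open>1 / (1 + \<bar>t\<bar> powr \<alpha>)\<close> is that of \<open>2 V\<close> at the same point. Every \<open>s \<ge> 0\<close> is of the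
  form \<open>t\<^sup>2 / 2\<close>, so that the continuity theorems for the two transforms apply together.
\<close>

lemma normal_mixture_linnik_iff:
  fixes U :: "nat \<Rightarrow> 'a \<Rightarrow> real"
  assumes M: "prob_space M" and U [measurable]: "\<And>n. U n \<in> borel_measurable M"
    and L: "linnik_rv \<alpha> P L" and V: "mittag_leffler_rv (\<alpha> / 2) Q V"
  shows "weak_conv_m (\<lambda>n. normal_mixture M (U n) (\<lambda>z. z)) (distr P borel L)
    \<longleftrightarrow> weak_conv_m (\<lambda>n. distr M borel (\<lambda>\<omega>. (U n \<omega>)\<^sup>2)) (distr Q borel (\<lambda>\<omega>. 2 * V \<omega>))"
proof -
  interpret M: prob_space M by fact
  have Q: "prob_space Q" and V_rv [measurable]: "V \<in> borel_measurable Q"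
    and V_nonneg: "\<And>\<omega>. \<omega> \<in> space Q \<Longrightarrow> 0 \<le> V \<omega>"
    and V_lap: "\<And>s. 0 \<le> s \<Longrightarrow> (\<integral>\<omega>. exp (- s * V \<omega>) \<partial>Q) = 1 / (1 + s powr (\<alpha> / 2))"
    using V by (auto simp: mittag_leffler_rv_def)
  have mix: "real_distribution (normal_mixture M (U n) (\<lambda>z. z))" for n
    by (rule M.real_distribution_normal_mixture) auto
  let ?E = "\<lambda>s n. \<integral>\<omega>. exp (- s * (U n \<omega>)\<^sup>2) \<partial>M"
  have laplace_eq: "(\<integral>\<omega>. exp (- (t\<^sup>2 / 2) * (2 * V \<omega>)) \<partial>Q) = 1 / (1 + \<bar>t\<bar> powr \<alpha>)" for t :: real
  proof -
    have "(t\<^sup>2) powr (\<alpha> / 2) = \<bar>t\<bar> powr \<alpha>"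
      using powr_powr[of "\<bar>t\<bar>" 2 "\<alpha> / 2"] by (cases "t = 0") auto
    then show ?thesis using V_lap[of "t\<^sup>2"] by simp
  qed
  have "weak_conv_m (\<lambda>n. normal_mixture M (U n) (\<lambda>z. z)) (distr P borel L)
    \<longleftrightarrow> (\<forall>t. (\<lambda>n. char (normal_mixture M (U n) (\<lambda>z. z)) t) \<longlonglongrightarrow> char (distr P borel L) t)"
    using levy_continuity[of "\<lambda>n. normal_mixture M (U n) (\<lambda>z. z)", OF mix linnik_distribution(1)[OF L]]
      levy_continuity1[of "\<lambda>n. normal_mixture M (U n) (\<lambda>z. z)", OF mix linnik_distribution(1)[OF L]]
    by blast
  also have "\<dots> \<longleftrightarrow> (\<forall>t. ?E (t\<^sup>2 / 2) \<longlonglongrightarrow> (\<integral>\<omega>. exp (- (t\<^sup>2 / 2) * (2 * V \<omega>)) \<partial>Q))"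
    unfolding M.char_normal_mixture[OF U] linnik_distribution(2)[OF L] laplace_eq tendsto_of_real_iff ..
  also have "\<dots> \<longleftrightarrow> (\<forall>s\<ge>0. ?E s \<longlonglongrightarrow> (\<integral>\<omega>. exp (- s * (2 * V \<omega>)) \<partial>Q))"
  proof safe
    fix s :: real assume s: "0 \<le> s" and *: "\<forall>t. ?E (t\<^sup>2 / 2) \<longlonglongrightarrow> (\<integral>\<omega>. exp (- (t\<^sup>2 / 2) * (2 * V \<omega>)) \<partial>Q)"
    have "(sqrt (2 * s))\<^sup>2 / 2 = s" using s by simp
    with *[rule_format, of "sqrt (2 * s)"] show "?E s \<longlonglongrightarrow> (\<integral>\<omega>. exp (- s * (2 * V \<omega>)) \<partial>Q)"
      by (simp only:)
  next
    fix t :: real assume "\<forall>s\<ge>0. ?E s \<longlonglongrightarrow> (\<integral>\<omega>. exp (- s * (2 * V \<omega>)) \<partial>Q)"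
    then show "?E (t\<^sup>2 / 2) \<longlonglongrightarrow> (\<integral>\<omega>. exp (- (t\<^sup>2 / 2) * (2 * V \<omega>)) \<partial>Q)"
      by (rule allE[of _ "t\<^sup>2 / 2"]) (simp del: mult_minus_left)
  qed
  also have "\<dots> \<longleftrightarrow> weak_conv_m (\<lambda>n. distr M borel (\<lambda>\<omega>. (U n \<omega>)\<^sup>2)) (distr Q borel (\<lambda>\<omega>. 2 * V \<omega>))"
    by (rule laplace_weak_conv_iff[symmetric]) (auto simp: M Q V_nonneg)
  finally show ?thesis .
qed

theorem theorem12:
  fixes M :: "'a measure" and X :: "nat \<Rightarrow> 'a \<Rightarrow> real" and N :: "nat \<Rightarrow> 'a \<Rightarrow> nat"
    and d :: "nat \<Rightarrow> real" and \<alpha> :: real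
    and P :: "'b measure" and L :: "'b \<Rightarrow> real"
    and Q :: "'c measure" and V :: "'c \<Rightarrow> real"
  assumes "prob_space M"
    and alpha: "0 < \<alpha>" "\<alpha> \<le> 2"
    and X_indep: "prob_space.indep_vars M (\<lambda>_. borel) X {1..}"
    and X_integrable: "\<And>i. i \<ge> 1 \<Longrightarrow> integrable M (X i)"
    and X_square_integrable: "\<And>i. i \<ge> 1 \<Longrightarrow> integrable M (\<lambda>\<omega>. (X i \<omega>)\<^sup>2)"
    and X_mean: "\<And>i. i \<ge> 1 \<Longrightarrow> prob_space.expectation M (X i) = 0"
    and X_variance: "\<And>i. i \<ge> 1 \<Longrightarrow> 0 < prob_space.variance M (X i)"
    and X_lindeberg: "lindeberg M X"
    and N_X_indep: "\<And>n. n \<ge> 1 \<Longrightarrow> prob_space.indep_vars M (\<lambda>_. borel)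
          (\<lambda>i. if i = 0 then (\<lambda>\<omega>. real (N n \<omega>)) else X i) {0..}"
    and N_tends: "tends_to_infinity_in_prob M N"
    and d_pos: "\<And>n. n \<ge> 1 \<Longrightarrow> d n > 0"
    and d_mono: "mono_on {1..} d"
    and d_tends: "filterlim d at_top sequentially"
    and L: "linnik_rv \<alpha> P L"
    and V: "mittag_leffler_rv (\<alpha> / 2) Q V"
  defines "stmt1 \<equiv> converges_in_distribution M
             (\<lambda>n \<omega>. sum_variance M X (N n \<omega>) / (d n)\<^sup>2) Q (\<lambda>\<omega>. 2 * V \<omega>)"
    and "stmt2 \<equiv> converges_in_distribution M
             (\<lambda>n \<omega>. partial_sum X (N n \<omega>) \<omega> / d n) P L"
    and "stmt3 \<equiv> converges_in_distribution M
             (\<lambda>n \<omega>. max_partial_sum X (N n \<omega>) \<omega> / d n) P (\<lambda>\<omega>. \<bar>L \<omega>\<bar>)"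
    and "stmt4 \<equiv> converges_in_distribution M
             (\<lambda>n \<omega>. min_partial_sum X (N n \<omega>) \<omega> / d n) P (\<lambda>\<omega>. - \<bar>L \<omega>\<bar>)"
    and "stmt5 \<equiv> converges_in_distribution M
             (\<lambda>n \<omega>. \<bar>partial_sum X (N n \<omega>) \<omega>\<bar> / d n) P (\<lambda>\<omega>. \<bar>L \<omega>\<bar>)"
  shows "(stmt1 \<longleftrightarrow> stmt2) \<and> (stmt1 \<longleftrightarrow> stmt3) \<and> (stmt1 \<longleftrightarrow> stmt4) \<and> (stmt1 \<longleftrightarrow> stmt5)"
proof -
  interpret lindeberg_sequence M X
    by (rule lindeberg_sequence.intro)
      (use assms(1) in \<open>auto intro!: lindeberg_sequence_axioms.intro X_indep X_square_integrable X_mean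
        X_variance X_lindeberg\<close>)
  \<comment> \<open>The hypotheses on \<open>N n\<close> and \<open>d n\<close> concern \<open>n \<ge> 1\<close>; after the shift they hold for all indices.\<close>
  define K where "K n = N (Suc n)" for n
  define e where "e n = d (Suc n)" for n
  define U where "U n \<omega> = B (K n \<omega>) / e n" for n \<omega>
  have e: "0 < e n" for n unfolding e_def by (rule d_pos) simp
  have K_X: "indep_vars (\<lambda>_. borel) (\<lambda>i. if i = 0 then (\<lambda>\<omega>. real (K n \<omega>)) else X i) {0..}" for n
    unfolding K_def by (rule N_X_indep) simp
  have K_rv [measurable]: "K n \<in> measurable M (count_space UNIV)" for n
  proof -
    have "(\<lambda>\<omega>. real (K n \<omega>)) \<in> borel_measurable M"
      using bspec[OF conjunct1[OF K_X[of n, unfolded indep_vars_def2]], of 0] by simp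
    then have "(\<lambda>\<omega>. nat \<lfloor>real (K n \<omega>)\<rfloor>) \<in> measurable M (count_space UNIV)"
      by measurable
    then show ?thesis by simp
  qed
  have K_tends: "tends_to_infinity_in_prob M K"
    unfolding tends_to_infinity_in_prob_def K_def
    using N_tends LIMSEQ_Suc unfolding tends_to_infinity_in_prob_def by blast
  have U_rv: "U n \<in> borel_measurable M" for n
    unfolding U_def[abs_def] by measurable
  have U_nonneg: "0 \<le> U n \<omega>" for n \<omega>
    using e[of n] B2_mono[of 0 "K n \<omega>"] by (simp add: U_def)
  have U_sq: "(U n \<omega>)\<^sup>2 = B2 (K n \<omega>) / (e n)\<^sup>2" for n \<omega>
    using B2_mono[of 0 "K n \<omega>"] by (simp add: U_def power_divide)
  note L_dist = linnik_distribution[OF L]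
  have L_rv [measurable]: "L \<in> borel_measurable P" using L by (simp add: linnik_rv_def)
  have mix: "real_distribution (normal_mixture M (U n) g)" if "g \<in> borel_measurable borel" for n g
    by (rule real_distribution_normal_mixture[OF U_rv that])
  have B_pos: "0 < B k" if "k \<ge> 1" for k using B2_pos[OF that] by simp

  have indep_S: "indep_var borel (\<lambda>\<omega>. real (K n \<omega>)) borel (partial_sum X k)" for n k
    using indep_var_index_path[OF K_X partial_sum_path_measurable[of k k]] by (simp only: partial_sum_path order_refl)
  have indep_max: "indep_var borel (\<lambda>\<omega>. real (K n \<omega>)) borel (max_partial_sum X k)" for n k
    using indep_var_index_path[OF K_X max_partial_sum_path_measurable[of k]] by (simp only: max_partial_sum_path order_refl)
  have indep_min: "indep_var borel (\<lambda>\<omega>. real (K n \<omega>)) borel (min_partial_sum X k)" for n k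
    using indep_var_index_path[OF K_X min_partial_sum_path_measurable[of k]] by (simp only: min_partial_sum_path order_refl)
  have indep_abs: "indep_var borel (\<lambda>\<omega>. real (K n \<omega>)) borel (\<lambda>\<omega>. \<bar>partial_sum X k \<omega>\<bar>)" for n k
    using indep_var_compose[OF indep_S, of "\<lambda>x. x" borel abs borel] by (simp add: comp_def)
  have id: "distr std_normal_distribution borel (\<lambda>z. z) = std_normal_distribution"
    by (rule distr_id2) simp

  have shift: "converges_in_distribution M (\<lambda>n \<omega>. W (N n \<omega>) \<omega> / d n) R Z
      \<longleftrightarrow> weak_conv_m (\<lambda>n. distr M borel (\<lambda>\<omega>. W (K n \<omega>) \<omega> / e n)) (distr R borel Z)"
    for W :: "nat \<Rightarrow> 'a \<Rightarrow> real" and R :: "'r measure" and Z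
    unfolding K_def e_def converges_in_distribution_def[symmetric]
    by (rule converges_in_distribution_Suc[symmetric])
  have 1: "stmt1 \<longleftrightarrow> weak_conv_m (\<lambda>n. distr M borel (\<lambda>\<omega>. (U n \<omega>)\<^sup>2)) (distr Q borel (\<lambda>\<omega>. 2 * V \<omega>))"
    unfolding stmt1_def
    by (subst converges_in_distribution_Suc[symmetric]) (simp add: converges_in_distribution_def U_sq K_def e_def)
  have 2: "stmt2 \<longleftrightarrow> weak_conv_m (\<lambda>n. normal_mixture M (U n) (\<lambda>z. z)) (distr P borel L)"
    unfolding stmt2_def
    unfolding shift U_def[abs_def]
    by (rule random_index_weak_conv_iff)
      (auto intro: indep_S K_tends B_pos e lindeberg_clt isCont_cdf_std_normal simp: id simp del: One_nat_def real_sqrt_gt_0_iff)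
  have 3: "stmt3 \<longleftrightarrow> weak_conv_m (\<lambda>n. normal_mixture M (U n) abs) (distr P borel (\<lambda>\<omega>. \<bar>L \<omega>\<bar>))"
    unfolding stmt3_def
    unfolding shift U_def[abs_def]
    by (rule random_index_weak_conv_iff)
      (auto intro: indep_max K_tends B_pos e max_partial_sum_weak_conv isCont_cdf_abs_std_normal simp del: One_nat_def real_sqrt_gt_0_iff)
  have 4: "stmt4 \<longleftrightarrow> weak_conv_m (\<lambda>n. normal_mixture M (U n) (\<lambda>z. - \<bar>z\<bar>)) (distr P borel (\<lambda>\<omega>. - \<bar>L \<omega>\<bar>))"
    unfolding stmt4_def
    unfolding shift U_def[abs_def]
    by (rule random_index_weak_conv_iff)
      (auto intro: indep_min K_tends B_pos e min_partial_sum_weak_conv isCont_cdf_neg_abs_std_normal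
        indep_var_rv2[OF indep_min] simp del: One_nat_def real_sqrt_gt_0_iff)
  have 5: "stmt5 \<longleftrightarrow> weak_conv_m (\<lambda>n. normal_mixture M (U n) abs) (distr P borel (\<lambda>\<omega>. \<bar>L \<omega>\<bar>))"
    unfolding stmt5_def shift[of "\<lambda>k \<omega>. \<bar>partial_sum X k \<omega>\<bar>"]
    unfolding U_def[abs_def]
    by (rule random_index_weak_conv_iff[where W = "\<lambda>k \<omega>. \<bar>partial_sum X k \<omega>\<bar>"])
      (auto intro: indep_abs K_tends B_pos e abs_partial_sum_weak_conv isCont_cdf_abs_std_normal simp del: One_nat_def real_sqrt_gt_0_iff)

  have abs_iff: "weak_conv_m (\<lambda>n. normal_mixture M (U n) abs) (distr P borel (\<lambda>\<omega>. \<bar>L \<omega>\<bar>))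
      \<longleftrightarrow> weak_conv_m (\<lambda>n. normal_mixture M (U n) (\<lambda>z. z)) (distr P borel L)"
  proof -
    have "distr (normal_mixture M (U n) (\<lambda>z. z)) borel abs = normal_mixture M (U n) abs" for n
      by (rule distr_normal_mixture) (auto simp: abs_mult U_nonneg U_rv)
    moreover have "distr (distr P borel L) borel abs = distr P borel (\<lambda>\<omega>. \<bar>L \<omega>\<bar>)"
      by (simp add: distr_distr comp_def)
    ultimately show ?thesis
      using weak_conv_m_abs_iff[OF mix L_dist(1), of "\<lambda>_ z. z"]
      by (simp add: char_normal_mixture[OF U_rv] L_dist(2))
  qed
  have neg_iff: "weak_conv_m (\<lambda>n. normal_mixture M (U n) (\<lambda>z. - \<bar>z\<bar>)) (distr P borel (\<lambda>\<omega>. - \<bar>L \<omega>\<bar>))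
      \<longleftrightarrow> weak_conv_m (\<lambda>n. normal_mixture M (U n) abs) (distr P borel (\<lambda>\<omega>. \<bar>L \<omega>\<bar>))"
  proof -
    have "distr (normal_mixture M (U n) abs) borel uminus = normal_mixture M (U n) (\<lambda>z. - \<bar>z\<bar>)" for n
      by (rule distr_normal_mixture) (auto simp: U_rv)
    moreover have "distr (distr P borel (\<lambda>\<omega>. \<bar>L \<omega>\<bar>)) borel uminus = distr P borel (\<lambda>\<omega>. - \<bar>L \<omega>\<bar>)"
      by (simp add: distr_distr comp_def)
    moreover have "real_distribution (distr P borel (\<lambda>\<omega>. \<bar>L \<omega>\<bar>))"
      using L by (intro prob_space.real_distribution_distr) (auto simp: linnik_rv_def)
    ultimately show ?thesis
      using weak_conv_m_uminus_iff[OF mix, of "\<lambda>_. abs" "distr P borel (\<lambda>\<omega>. \<bar>L \<omega>\<bar>)"] by simp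
  qed
  show ?thesis
    using 1 2 3 4 5 abs_iff neg_iff normal_mixture_linnik_iff[where U=U, OF assms(1) U_rv L V] by blast
qed

end
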